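(* Let $M'=2^{m'}$, $M''=2^{m''}$ with $m',m''\ge1$, and $M=M'M''=2^m$. Let $\mathbb{X}_{\mathrm{QAM}}$ be the rectangular $(M'\times M'')$-QAM input alphabet and $\mathbb{L}$ a binary labeling of order $m$. The constellation $[\mathbb{X}_{\mathrm{QAM}},\mathbb{L},\mathbb{U}_M]$ is first-order optimal (FOO) for BICM if and only if $\mathbb{L}=\mathbb{N}_m$ (the natural binary code), or $\mathbb{L}$ is any other binary labeling that can be derived from $\mathbb{N}_m$ by inverting the bits in certain positions (complementing some columns) and/or by permuting the sequence of bits in all codewords (permuting the columns).
   Context: QAM. The $M$-PAM input alphabet is the column vector with entries $-(M-2i-1)$, $i=0,\ldots,M-1$. Let $x'_l$ ($l=0,\ldots,M'-1$) and $x''_j$ ($j=0,\ldots,M''-1$) be the entries of the $M'$-PAM and $M''$-PAM input alphabets. The rectangular $(M'\times M'')$-QAM input alphabet $\mathbb{X}_{\mathrm{QAM}}$ is their ordered direct product, i.e. the $M'M''\times 2$ matrix with rows $\boldsymbol{x}_{M''l+j}=[x'_l,x''_j]$ (dimension $N=2$). Labelings. A binary labeling $\mathbb{L}$ of order $m$ is an $M\times m$ matrix whose rows $\boldsymbol{c}_i=[c_{i,0},\ldots,c_{i,m-1}]$, $i=0,\ldots,M-1$, are the $M$ distinct elements of $\{0,1\}^m$. The natural binary code (NBC) $\mathbb{N}_m$ is the labeling whose row $\boldsymbol{c}_i$ is the base-2 representation of $i$, most significant bit first. Constellations. $\Omega=[\mathbb{X},\mathbb{L},\mathbb{U}_M]$,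 where $\mathbb{X}$ has rows $\boldsymbol{x}_0,\ldots,\boldsymbol{x}_{M-1}\in\mathbb{R}^N$, denotes the constellation in which the bits $C_0,\ldots,C_{m-1}$ are independent and uniform on $\{0,1\}$ and the transmitted symbol is $\boldsymbol{X}=\boldsymbol{x}_i$ when $[C_0,\ldots,C_{m-1}]=\boldsymbol{c}_i$. Put $E_s=\mathbb{E}[\|\boldsymbol{X}\|^2]$. Channel. $\boldsymbol{Y}=\boldsymbol{H}\circ\boldsymbol{X}+\boldsymbol{Z}$, where $\circ$ is the element-wise product, $\boldsymbol{X},\boldsymbol{H},\boldsymbol{Z}$ are mutually independent, $\boldsymbol{Z}$ is Gaussian in $\mathbb{R}^N$ with independent zero-mean components of variance $N_0/2$, and $\boldsymbol{H}$ is a real random vector whose $N$ components (possibly dependent) all have the same distribution, that of a random variable $H$, with $0<\mathbb{E}[H^2]<\infty$. It is assumed that there is $\omega>0$ such that $\Pr\{\|\boldsymbol{H}\|^2>\Delta\}\le\exp(-\Delta^\omega)$ for all sufficiently large $\Delta>0$. $\boldsymbol{H}$ and $N_0$ are known at the receiver. Define $\mathsf{SNR}=\mathbb{E}[H^2]\,E_s/N_0$; the constellation and the law of $\boldsymbol{H}$ are fixed and $N_0$ varies over $(0,\infty)$, so $\mathsf{SNR}\to0$ means $N_0\to\infty$. BICM capacity (in bits). $\mathsf{I}^{\mathrm{BI}}_\Omega(\mathsf{SNR})=\sum_{k=0}^{m-1}\mathbb{E}\left[\log_2\frac{p_{\boldsymbol{Y}|C_k,\boldsymbol{H}}(\boldsymbol{Y})}{p_{\boldsymbol{Y}|\boldsymbol{H}}(\boldsymbol{Y})}\right]$.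 The coefficient $\alpha^{\mathrm{BI}}_\Omega$ is defined by $\mathsf{I}^{\mathrm{BI}}_\Omega(\mathsf{SNR})=\alpha^{\mathrm{BI}}_\Omega\,\mathsf{SNR}+O(\mathsf{SNR}^2)$ as $\mathsf{SNR}\to 0$. The constellation $\Omega$ is first-order optimal (FOO) for BICM if $\alpha^{\mathrm{BI}}_\Omega=\log_2 e$. *)

theory Defs
  imports
    "HOL-Probability.Probability"
    "HOL-Library.Landau_Symbols"
    "HOL-Combinatorics.Combinatorics"
begin

section \<open>Input alphabets and binary labelings\<close>

text \<open>
  An input alphabet is the list of its rows (in order), and a labeling is the list of its
  codewords; \<^term>\<open>True\<close> is the bit 1.
\<close>

definition pam :: "nat \<Rightarrow> real list" where
  "pam M = map (\<lambda>i. - (real M - 2 * real i - 1)) [0..<M]"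

definition qam :: "nat \<Rightarrow> nat \<Rightarrow> (real ^ 2) list" where
  "qam M1 M2 = map (\<lambda>(a, b). vector [a, b]) (List.product (pam M1) (pam M2))"

lemma length_qam: "length (qam M1 M2) = M1 * M2"
  by (simp add: qam_def pam_def length_product)

lemma qam_nth:
  assumes "l < M1" "j < M2"
  shows "qam M1 M2 ! (M2 * l + j) = vector [pam M1 ! l, pam M2 ! j]"
proof -
  have "M2 * l + j < M2 * Suc l" using assms by simp
  also have "\<dots> \<le> M2 * M1" using assms by (intro mult_le_mono2) simp
  finally have "M2 * l + j < M1 * M2" by (simp add: mult.commute)
  with assms show ?thesis
    by (simp add: qam_def pam_def length_product product_nth)
qed

definition binary_labeling :: "nat \<Rightarrow> bool list list \<Rightarrow> bool" where
  "binary_labeling m L \<longleftrightarrow> distinct L \<and> set L = {c. length c = m}"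

lemma binary_labeling_length: "binary_labeling m L \<Longrightarrow> length L = 2 ^ m"
  using card_lists_length_eq[of "UNIV :: bool set" m] distinct_card[of L]
  by (simp add: binary_labeling_def)

text \<open>Natural binary code: the most significant bit comes first.\<close>

definition nbc :: "nat \<Rightarrow> bool list list" where
  "nbc m = map (\<lambda>i. map (\<lambda>k. bit i (m - 1 - k)) [0..<m]) [0..<2 ^ m]"

definition invert_columns :: "nat set \<Rightarrow> bool list list \<Rightarrow> bool list list" where
  "invert_columns S L = map (\<lambda>c. map (\<lambda>k. c ! k \<noteq> (k \<in> S)) [0..<length c]) L"

definition permute_columns :: "(nat \<Rightarrow> nat) \<Rightarrow> bool list list \<Rightarrow> bool list list" where
  "permute_columns \<sigma> L = map (permute_list \<sigma>) L"

definition derivable_labeling :: "nat \<Rightarrow> bool list list \<Rightarrow> bool list list \<Rightarrow> bool" where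
  "derivable_labeling m L L' \<longleftrightarrow>
     (\<exists>S \<sigma>. S \<subseteq> {..<m} \<and> \<sigma> permutes {..<m} \<and> L' = permute_columns \<sigma> (invert_columns S L))"


section \<open>Transmitter\<close>

definition code_bits :: "nat \<Rightarrow> bool list pmf" where
  "code_bits m = replicate_pmf m (bernoulli_pmf (1 / 2))"

definition tx_symbol :: "'a list \<Rightarrow> bool list list \<Rightarrow> bool list \<Rightarrow> 'a" where
  "tx_symbol X L c = X ! (THE i. i < length L \<and> L ! i = c)"

definition symbol_energy :: "nat \<Rightarrow> (real ^ 'n) list \<Rightarrow> bool list list \<Rightarrow> real" where
  "symbol_energy m X L = measure_pmf.expectation (code_bits m) (\<lambda>c. (norm (tx_symbol X L c))\<^sup>2)"


section \<open>Channel\<close>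

text \<open>
  \<open>\<nu>\<close> is the law of the fading vector and \<open>\<kappa>\<close> the common law of its components, which need not
  be independent.
\<close>

definition fading_law :: "(real ^ 'n) measure \<Rightarrow> real measure \<Rightarrow> bool" where
  "fading_law \<nu> \<kappa> \<longleftrightarrow>
     prob_space \<nu> \<and> sets \<nu> = sets borel \<and>
     (\<forall>i. distr \<nu> borel (\<lambda>h. h $ i) = \<kappa>) \<and>
     integrable \<kappa> (\<lambda>t. t\<^sup>2) \<and> 0 < (LINT t|\<kappa>. t\<^sup>2) \<and>
     (\<exists>\<omega>>0. \<forall>\<^sub>F \<Delta> in at_top.
        measure \<nu> {h. (norm h)\<^sup>2 > \<Delta>} \<le> exp (- (\<Delta> powr \<omega>)))"

definition noise_density :: "real \<Rightarrow> real ^ 'n \<Rightarrow> real" where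
  "noise_density N0 z = (\<Prod>i\<in>UNIV. normal_density 0 (sqrt (N0 / 2)) (z $ i))"

definition noise :: "real \<Rightarrow> (real ^ 'n) measure" where
  "noise N0 = density lborel (noise_density N0)"

text \<open>
  The joint law of bits, fading and noise is the product measure, i.e. these are mutually
  independent. Multiplication on \<^typ>\<open>real ^ 'n\<close> is the element-wise product.
\<close>

definition channel_space ::
  "bool list pmf \<Rightarrow> (real ^ 'n) measure \<Rightarrow> real \<Rightarrow> (bool list \<times> (real ^ 'n) \<times> (real ^ 'n)) measure"
where
  "channel_space D \<nu> N0 = measure_pmf D \<Otimes>\<^sub>M (\<nu> \<Otimes>\<^sub>M noise N0)"

definition received ::
  "(real ^ 'n) list \<Rightarrow> bool list list \<Rightarrow> bool list \<Rightarrow> real ^ 'n \<Rightarrow> real ^ 'n \<Rightarrow> real ^ 'n" where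
  "received X L c h z = h * tx_symbol X L c + z"

text \<open>
  Density at \<open>y\<close> of the received vector given fading \<open>h\<close> when the codeword has law \<open>D\<close>: the mixture
  over \<open>D\<close> of the transition densities \<open>p(y | x, h)\<close>. The lemma \<open>distr_output_density\<close> below shows
  that it is the conditional density with respect to Lebesgue measure.
\<close>

definition output_density ::
  "(real ^ 'n) list \<Rightarrow> bool list list \<Rightarrow> real \<Rightarrow> bool list pmf \<Rightarrow> real ^ 'n \<Rightarrow> real ^ 'n \<Rightarrow> real" where
  "output_density X L N0 D h y =
     measure_pmf.expectation D (\<lambda>c. noise_density N0 (y - h * tx_symbol X L c))"

definition density_given_fading ::
  "nat \<Rightarrow> (real ^ 'n) list \<Rightarrow> bool list list \<Rightarrow> real \<Rightarrow> real ^ 'n \<Rightarrow> real ^ 'n \<Rightarrow> real" where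
  "density_given_fading m X L N0 = output_density X L N0 (code_bits m)"

definition density_given_bit_fading ::
  "nat \<Rightarrow> (real ^ 'n) list \<Rightarrow> bool list list \<Rightarrow> real \<Rightarrow> nat \<Rightarrow> bool
     \<Rightarrow> real ^ 'n \<Rightarrow> real ^ 'n \<Rightarrow> real" where
  "density_given_bit_fading m X L N0 k b =
     output_density X L N0 (cond_pmf (code_bits m) {c. c ! k = b})"


section \<open>BICM capacity and first-order optimality\<close>

definition bicm_capacity ::
  "nat \<Rightarrow> (real ^ 'n) list \<Rightarrow> bool list list \<Rightarrow> (real ^ 'n) measure \<Rightarrow> real \<Rightarrow> real" where
  "bicm_capacity m X L \<nu> N0 =
     (\<Sum>k<m. LINT (c, h, z)|channel_space (code_bits m) \<nu> N0.
        (let y = received X L c h z in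
         log 2 (density_given_bit_fading m X L N0 k (c ! k) h y / density_given_fading m X L N0 h y)))"

definition snr ::
  "nat \<Rightarrow> (real ^ 'n) list \<Rightarrow> bool list list \<Rightarrow> real measure \<Rightarrow> real \<Rightarrow> real" where
  "snr m X L \<kappa> N0 = (LINT t|\<kappa>. t\<^sup>2) * symbol_energy m X L / N0"

text \<open>
  The constellation and the fading law being fixed, the limit of vanishing SNR is \<open>N0 \<rightarrow> \<infinity>\<close>.
  When the symbol energy is positive, at most one \<open>\<alpha>\<close> satisfies the expansion.
\<close>

definition is_bicm_coeff ::
  "nat \<Rightarrow> (real ^ 'n) list \<Rightarrow> bool list list \<Rightarrow> (real ^ 'n) measure \<Rightarrow> real measure \<Rightarrow> real \<Rightarrow> bool"
where
  "is_bicm_coeff m X L \<nu> \<kappa> \<alpha> \<longleftrightarrow>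
     (\<lambda>N0. bicm_capacity m X L \<nu> N0 - \<alpha> * snr m X L \<kappa> N0) \<in> O[at_top](\<lambda>N0. (snr m X L \<kappa> N0)\<^sup>2)"

definition bicm_foo ::
  "nat \<Rightarrow> (real ^ 'n) list \<Rightarrow> bool list list \<Rightarrow> (real ^ 'n) measure \<Rightarrow> real measure \<Rightarrow> bool" where
  "bicm_foo m X L \<nu> \<kappa> \<longleftrightarrow> is_bicm_coeff m X L \<nu> \<kappa> (log 2 (exp 1))"


section \<open>The densities are conditional densities\<close>

lemma noise_density_nonneg: "0 \<le> noise_density N0 z"
  by (simp add: noise_density_def prod_nonneg)

lemma noise_density_measurable [measurable]: "noise_density N0 \<in> borel_measurable borel"
  unfolding noise_density_def by measurable

lemma prob_space_noise:
  assumes "N0 > 0"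
  shows "prob_space (noise N0 :: (real ^ 'n) measure)"
proof (rule prob_spaceI)
  let ?f = "\<lambda>t. ennreal (normal_density 0 (sqrt (N0 / 2)) t)"
  have Basis: "(Basis :: (real ^ 'n) set) = range (\<lambda>i. axis i 1)"
    by (auto simp: Basis_vec_def)
  have inj: "inj (\<lambda>i :: 'n. axis i (1 :: real))"
    by (auto simp: inj_on_def axis_eq_axis)
  have one: "(\<integral>\<^sup>+ t. ?f t \<partial>lborel) = 1"
    using prob_space.emeasure_space_1[OF prob_space_normal_density[of "sqrt (N0 / 2)" 0]] assms
    by (simp add: emeasure_density)
  have "ennreal (noise_density N0 z) = (\<Prod>b\<in>Basis. ?f (z \<bullet> b))" for z :: "real ^ 'n"
    by (simp add: noise_density_def Basis prod.reindex[OF inj] inner_axis prod_ennreal)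
  then have "emeasure (noise N0 :: (real ^ 'n) measure) (space (noise N0)) =
      (\<integral>\<^sup>+ z. (\<Prod>b\<in>Basis. ?f (z \<bullet> b)) \<partial>(lborel :: (real ^ 'n) measure))"
    by (simp add: noise_def emeasure_density)
  also have "\<dots> = (\<Prod>b\<in>(Basis :: (real ^ 'n) set). \<integral>\<^sup>+ t. ?f t \<partial>lborel)"
    by (rule nn_integral_lborel_prod) simp_all
  finally show "emeasure (noise N0 :: (real ^ 'n) measure) (space (noise N0)) = 1"
    by (simp add: one)
qed

lemma measurable_vec_mult [measurable]:
  fixes x :: "real ^ 'n"
  shows "(\<lambda>h. h * x) \<in> borel_measurable borel"
proof -
  have "continuous_on UNIV (\<lambda>h :: real ^ 'n. \<chi> i. h $ i * x $ i)"
    by (intro continuous_intros)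
  then show ?thesis
    by (auto simp: times_vec_def intro: borel_measurable_continuous_onI)
qed

text \<open>
  Taking \<open>D = code_bits m\<close> gives \<open>p(y | h)\<close>, and \<open>D = cond_pmf (code_bits m) {c. c ! k = b}\<close> gives
  \<open>p(y | C\<^sub>k = b, h)\<close>.
\<close>

lemma distr_output_density:
  fixes \<nu> :: "(real ^ 'n) measure"
  assumes "prob_space \<nu>" and sets: "sets \<nu> = sets borel" and fin: "finite (set_pmf D)"
    and "N0 > 0"
  shows "distr (channel_space D \<nu> N0) (borel \<Otimes>\<^sub>M borel) (\<lambda>(c, h, z). (h, received X L c h z)) =
         density (\<nu> \<Otimes>\<^sub>M lborel) (\<lambda>(h, y). output_density X L N0 D h y)"
    (is "?l = ?r")
proof (rule measure_eqI)
  show "sets ?l = sets ?r"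
    by (simp cong: sets_pair_measure_cong add: sets)
next
  interpret \<nu>: prob_space \<nu> by fact
  interpret nz: prob_space "noise N0 :: (real ^ 'n) measure"
    by (rule prob_space_noise) fact
  have sf: "sigma_finite_measure (\<nu> \<Otimes>\<^sub>M (noise N0 :: (real ^ 'n) measure))"
    by (intro prob_space_imp_sigma_finite prob_space_pair) unfold_locales
  note [measurable_cong] = sets
  have [measurable_cong]: "sets (noise N0 :: (real ^ 'n) measure) = sets borel"
    by (simp add: noise_def)
  fix A assume "A \<in> sets ?l"
  then have A[measurable]: "A \<in> sets (borel \<Otimes>\<^sub>M borel)" by simp
  let ?s = "tx_symbol X L"
  have m1[measurable]: "(\<lambda>h. h * ?s c) \<in> borel_measurable borel" for c
    by (rule measurable_vec_mult)
  have mc: "(\<lambda>(h, z). (h, received X L c h z)) \<in> measurable (\<nu> \<Otimes>\<^sub>M noise N0) (borel \<Otimes>\<^sub>M borel)" for c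
    unfolding received_def by measurable
  have meas: "(\<lambda>(c, h, z). (h, received X L c h z)) \<in>
      measurable (channel_space D \<nu> N0) (borel \<Otimes>\<^sub>M borel)"
  proof -
    have "(\<lambda>(c, h, z). (h, received X L c h z)) \<in>
        measurable (count_space UNIV \<Otimes>\<^sub>M (\<nu> \<Otimes>\<^sub>M noise N0)) (borel \<Otimes>\<^sub>M borel)"
      by (rule measurable_pair_measure_countable1) (use mc in simp_all)
    moreover have "sets (channel_space D \<nu> N0) =
        sets (count_space UNIV \<Otimes>\<^sub>M (\<nu> \<Otimes>\<^sub>M noise N0))"
      unfolding channel_space_def by (rule sets_pair_measure_cong) simp_all
    ultimately show ?thesis
      using measurable_cong_sets[OF _ refl] by blast
  qed
  have shift: "(\<integral>\<^sup>+ z. ennreal (noise_density N0 z) * indicator A (h, h * x + z) \<partial>lborel) =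
               (\<integral>\<^sup>+ y. ennreal (noise_density N0 (y - h * x)) * indicator A (h, y) \<partial>lborel)"
    for h x :: "real ^ 'n"
  proof -
    have "(\<integral>\<^sup>+ y. ennreal (noise_density N0 (y - h * x)) * indicator A (h, y) \<partial>lborel) =
          (\<integral>\<^sup>+ y. ennreal (noise_density N0 (y - h * x)) * indicator A (h, y)
             \<partial>(distr lborel borel ((+) (h * x))))"
      by (simp add: lborel_distr_plus)
    also have "\<dots> = (\<integral>\<^sup>+ z. ennreal (noise_density N0 z) * indicator A (h, h * x + z) \<partial>lborel)"
      by (subst nn_integral_distr) simp_all
    finally show ?thesis by simp
  qed
  have "emeasure ?l A = (\<integral>\<^sup>+ w. indicator A w \<partial>?l)"
    by simp
  also have "\<dots> = (\<integral>\<^sup>+ w. indicator A (case w of (c, h, z) \<Rightarrow> (h, received X L c h z))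
      \<partial>channel_space D \<nu> N0)"
    by (rule nn_integral_distr[OF meas]) simp
  also have "\<dots> = (\<integral>\<^sup>+ c. \<integral>\<^sup>+ q. indicator A (case q of (h, z) \<Rightarrow> (h, received X L c h z))
      \<partial>(\<nu> \<Otimes>\<^sub>M noise N0) \<partial>measure_pmf D)"
    unfolding channel_space_def
    apply (subst sigma_finite_measure.nn_integral_fst[OF sf, symmetric])
    subgoal
      using measurable_compose[OF meas, of "indicator A :: _ \<Rightarrow> ennreal" borel]
      by (simp add: channel_space_def)
    by simp
  also have "\<dots> = (\<integral>\<^sup>+ c. \<integral>\<^sup>+ h. \<integral>\<^sup>+ z. indicator A (h, h * ?s c + z) \<partial>noise N0 \<partial>\<nu> \<partial>measure_pmf D)"
    by (subst nz.nn_integral_fst[symmetric])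
      (auto simp: received_def intro!: measurable_compose[OF mc[unfolded received_def]])
  also have "\<dots> = (\<integral>\<^sup>+ c. \<integral>\<^sup>+ h. \<integral>\<^sup>+ y. ennreal (noise_density N0 (y - h * ?s c)) * indicator A (h, y)
      \<partial>lborel \<partial>\<nu> \<partial>measure_pmf D)"
    by (simp add: noise_def nn_integral_density shift)
  also have "\<dots> = (\<integral>\<^sup>+ c. \<integral>\<^sup>+ (h, y). ennreal (noise_density N0 (y - h * ?s c)) * indicator A (h, y)
      \<partial>(\<nu> \<Otimes>\<^sub>M lborel) \<partial>measure_pmf D)"
    by (subst lborel.nn_integral_fst[symmetric]) (auto simp: split_beta')
  also have "\<dots> = (\<Sum>c\<in>set_pmf D. (\<integral>\<^sup>+ (h, y). ennreal (noise_density N0 (y - h * ?s c)) * indicator A (h, y)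
      \<partial>(\<nu> \<Otimes>\<^sub>M lborel)) * pmf D c)"
    by (rule nn_integral_measure_pmf_finite[OF fin]) simp
  also have "\<dots> = (\<integral>\<^sup>+ q. (\<Sum>c\<in>set_pmf D. (case q of (h, y) \<Rightarrow>
      ennreal (noise_density N0 (y - h * ?s c)) * indicator A (h, y)) * pmf D c) \<partial>(\<nu> \<Otimes>\<^sub>M lborel))"
    by (subst nn_integral_sum) (auto simp: nn_integral_multc)
  also have "\<dots> = (\<integral>\<^sup>+ (h, y). ennreal (output_density X L N0 D h y) * indicator A (h, y) \<partial>(\<nu> \<Otimes>\<^sub>M lborel))"
  proof (rule nn_integral_cong, clarify)
    fix h y :: "real ^ 'n"
    have "output_density X L N0 D h y = (\<Sum>c\<in>set_pmf D. noise_density N0 (y - h * ?s c) * pmf D c)"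
      unfolding output_density_def using fin by (subst integral_measure_pmf_real[of "set_pmf D"]) auto
    then show "(\<Sum>c\<in>set_pmf D. ennreal (noise_density N0 (y - h * ?s c)) * indicator A (h, y) * pmf D c)
       = ennreal (output_density X L N0 D h y) * indicator A (h, y)"
      by (auto simp: indicator_def sum_ennreal ennreal_mult'[symmetric] noise_density_nonneg)
  qed
  also have "\<dots> = emeasure ?r A"
  proof -
    have "(\<lambda>(h, y). output_density X L N0 D h y) \<in> borel_measurable (\<nu> \<Otimes>\<^sub>M lborel)"
      unfolding output_density_def
      by (subst integral_measure_pmf_real[OF fin]) (auto simp: set_pmf_iff split_beta')
    then show ?thesis
      by (subst emeasure_density)
        (auto simp: split_beta' sets cong: sets_pair_measure_cong)
  qed
  finally show "emeasure ?l A = emeasure ?r A" .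
qed

end

theory Submission
  imports Defs "HOL-Real_Asymp.Real_Asymp"
begin

text \<open>
  Given the fading, the information carried by one bit is the Jensen gap of \<open>u ln u\<close> at the mean
  likelihood ratios of the two half constellations. Bounding \<open>u ln u\<close> by its cubic Taylor polynomial
  at \<open>1\<close> up to a quartic error, and computing the moments of the likelihood ratios exactly, gives
  the first-order term with an error of order \<open>(norm h)\<^sup>4 / N0\<^sup>2\<close>, uniformly in \<open>h\<close> because the gap lies
  in \<open>[0, ln 2]\<close> anyway; the tail condition makes this error integrable. Hence the constellation is
  first-order optimal iff Bessel's inequality for the symbol, as a function of the bits, against
  the \<open>m\<close> signs \<open>\<plusminus>1\<close> of the individual bits is an equality, i.e. iff the symbol is a linear
  combination of these signs.

  For a rectangular constellation, counting the points with the largest first (second) coordinate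
  shows that every coefficient vector lies on an axis. On an axis the absolute values
  have all of \<open>0, \<dots>, 2\<^sup>n - 1\<close> as subset sums, each exactly once, so they are \<open>1, 2, \<dots>, 2\<^sup>n\<^sup>-\<^sup>1\<close>. This
  is the natural binary code up to signs and order.
\<close>

section \<open>Expansions of the entropy function and the exponential\<close>

text \<open>The remainder must be quadratic in \<open>1 / N0\<close>. A likelihood ratio fluctuates
  about 1 on the scale of the square root of \<open>1 / N0\<close>, so an expansion of degree two
  would leave an absolute third moment of order 3/2 in \<open>1 / N0\<close>, which is too large.
  With the cubic term kept, the third moment is a signed one whose leading part cancels, and the
  fourth moment already has the right order. All moments are taken under the unshifted noise, where
  products of likelihood ratios integrate to exponentials of inner products.

  Fading is a second obstacle: for fixed \<open>N0\<close> the vectors \<open>h * x\<close> can be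
  arbitrarily long, and Taylor estimates say nothing there. The trivial bounds on the gap cover that
  range at the price of a larger constant.

  On the combinatorial side, the set of values of one coordinate does not limit the number of bits
  that influence it: the coefficients 1, 1, 1 already produce -3, -1, 1, 3. The multiplicity of the
  largest value does limit it.\<close>

lemma ln_add_one_le_cubic:
  fixes g :: real
  assumes "-1 < g"
  shows "ln (1 + g) \<le> g - g\<^sup>2 / 2 + g ^ 3 / 3"
proof -
  define f where "f = (\<lambda>x::real. x - x\<^sup>2 / 2 + x ^ 3 / 3 - ln (1 + x))"
  \<comment> \<open>The derivative has the sign of \<open>x\<close>, so \<open>f\<close> is smallest
    at 0.\<close>
  have D: "(f has_real_derivative x ^ 3 / (1 + x)) (at x)" if "-1 < x" for x
    unfolding f_def
    using that by (auto intro!: derivative_eq_intros simp: field_simps power2_eq_square power3_eq_cube)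
  have "f 0 \<le> f g"
  proof (cases "0 \<le> g")
    case True
    show ?thesis
    proof (rule DERIV_nonneg_imp_nondecreasing[OF True])
      fix x :: real assume "0 \<le> x" "x \<le> g"
      then show "\<exists>y. (f has_real_derivative y) (at x) \<and> 0 \<le> y"
        using D[of x] by (intro exI[of _ "x ^ 3 / (1 + x)"]) auto
    qed
  next
    case False
    show ?thesis
    proof (rule DERIV_nonpos_imp_nonincreasing[of g 0 f])
      show "g \<le> 0" using False by simp
      fix x :: real assume "g \<le> x" "x \<le> 0"
      then show "\<exists>y. (f has_real_derivative y) (at x) \<and> y \<le> 0"
        using D[of x] assms
        by (intro exI[of _ "x ^ 3 / (1 + x)"]) (auto intro!: divide_nonpos_pos simp: power_le_zero_eq)
    qed
  qed
  then show ?thesis by (simp add: f_def)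
qed

text \<open>Multiplying the cubic bound on the logarithm by \<open>u\<close> raises the degree to
  four; this is where the quartic error comes from.\<close>

lemma entropy_le_quartic:
  fixes u :: real
  assumes "0 < u"
  shows "u * ln u \<le> (u - 1) + (u - 1)\<^sup>2 / 2 - (u - 1) ^ 3 / 6 + (u - 1) ^ 4 / 3"
proof -
  have "u * ln u \<le> u * ((u - 1) - (u - 1)\<^sup>2 / 2 + (u - 1) ^ 3 / 3)"
    using ln_add_one_le_cubic[of "u - 1"] assms by (intro mult_left_mono) auto
  also have "\<dots> = (u - 1) + (u - 1)\<^sup>2 / 2 - (u - 1) ^ 3 / 6 + (u - 1) ^ 4 / 3"
    by (simp add: field_simps power2_eq_square power3_eq_cube power4_eq_xxxx)
  finally show ?thesis .
qed

text \<open>The difference \<open>f\<close> of the two sides has the derivative \<open>f'\<close>,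
  which is nondecreasing because its own derivative is \<open>(x - 1)^2 / x\<close>. As
  \<open>f'\<close> vanishes at 1, \<open>f\<close> is smallest there.\<close>

lemma entropy_ge_cubic:
  fixes u :: real
  assumes "0 < u"
  shows "(u - 1) + (u - 1)\<^sup>2 / 2 - (u - 1) ^ 3 / 6 \<le> u * ln u"
proof -
  define f' where "f' = (\<lambda>x::real. ln x - (x - 1) + (x - 1)\<^sup>2 / 2)"
  define f where "f = (\<lambda>x::real. x * ln x - ((x - 1) + (x - 1)\<^sup>2 / 2 - (x - 1) ^ 3 / 6))"
  have D: "(f has_real_derivative f' x) (at x)" if "0 < x" for x
    unfolding f_def f'_def
    using that by (auto intro!: derivative_eq_intros simp: field_simps power2_eq_square power3_eq_cube)
  have D': "(f' has_real_derivative (x - 1)\<^sup>2 / x) (at x)" if "0 < x" for x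
    unfolding f'_def
    using that by (auto intro!: derivative_eq_intros simp: field_simps power2_eq_square power3_eq_cube)
  have mono: "f' x \<le> f' y" if "0 < x" "x \<le> y" for x y
  proof (rule DERIV_nonneg_imp_nondecreasing[OF that(2)])
    fix t :: real assume "x \<le> t" "t \<le> y"
    then show "\<exists>y. (f' has_real_derivative y) (at t) \<and> 0 \<le> y"
      using D'[of t] that by (intro exI[of _ "(t - 1)\<^sup>2 / t"]) auto
  qed
  have f'1: "f' 1 = 0" by (simp add: f'_def)
  have "f 1 \<le> f u"
  proof (cases "1 \<le> u")
    case True
    show ?thesis
    proof (rule DERIV_nonneg_imp_nondecreasing[OF True])
      fix x :: real assume "1 \<le> x" "x \<le> u"
      then show "\<exists>y. (f has_real_derivative y) (at x) \<and> 0 \<le> y"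
        using D[of x] mono[of 1 x] f'1 by (intro exI[of _ "f' x"]) auto
    qed
  next
    case False
    show ?thesis
    proof (rule DERIV_nonpos_imp_nonincreasing[of u 1 f])
      show "u \<le> 1" using False by simp
      fix x :: real assume "u \<le> x" "x \<le> 1"
      then show "\<exists>y. (f has_real_derivative y) (at x) \<and> y \<le> 0"
        using D[of x] mono[of x 1] f'1 assms by (intro exI[of _ "f' x"]) auto
    qed
  qed
  then show ?thesis by (simp add: f_def)
qed

lemma abs_exp_minus_linear_le:
  fixes x :: real
  assumes "\<bar>x\<bar> \<le> 1"
  shows "\<bar>exp x - 1 - x\<bar> \<le> x\<^sup>2"
proof -
  have "exp x \<le> 1 + x + x\<^sup>2"
  proof (cases "0 \<le> x")
    case True
    then show ?thesis using assms by (intro exp_bound) auto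
  next
    case False
    define t where "t = - x"
    have t: "0 \<le> t" "1 - t + t\<^sup>2 \<ge> 0"
      using False zero_le_power2[of "t - 1 / 2"] by (auto simp: t_def power2_eq_square algebra_simps)
    \<comment> \<open>The product expands to \<open>1 + t^2/2 + t^3/2 + t^4/2\<close>. The second
      factor is the quadratic Taylor lower bound of \<open>exp t\<close>.\<close>
    have "1 \<le> (1 - t + t\<^sup>2) * (1 + t + t\<^sup>2 / 2)"
      using t by (simp add: field_simps power2_eq_square)
    also have "\<dots> \<le> (1 - t + t\<^sup>2) * exp t"
      using t exp_lower_Taylor_quadratic[of t] by (intro mult_left_mono) auto
    finally have "1 / exp t \<le> 1 - t + t\<^sup>2" by (simp add: field_simps)
    then show ?thesis by (simp add: t_def exp_minus field_simps)
  qed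
  moreover have "0 \<le> exp x - 1 - x" using exp_ge_add_one_self[of x] by linarith
  ultimately show ?thesis by (simp add: abs_of_nonneg)
qed

section \<open>Moments of Gaussian likelihood ratios\<close>

lemma sets_noise [simp, measurable_cong]: "sets (noise N0) = sets borel"
  by (simp add: noise_def)

lemma space_noise [simp]: "space (noise N0) = UNIV"
  by (simp add: noise_def)

text \<open>
  The likelihood ratio of the noise shifted by \<open>a\<close> against the noise itself.
\<close>

definition lik :: "real \<Rightarrow> real ^ 'n \<Rightarrow> real ^ 'n \<Rightarrow> real" where
  "lik N0 a y = exp ((2 * (y \<bullet> a) - a \<bullet> a) / N0)"

lemma lik_pos: "0 < lik N0 a y"
  by (simp add: lik_def)

lemma lik_measurable [measurable]: "lik N0 a \<in> borel_measurable borel"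
  unfolding lik_def by measurable

lemma noise_density_eq_exp:
  fixes z :: "real ^ 'n"
  assumes "0 < N0"
  shows "noise_density N0 z = (1 / sqrt (pi * N0)) ^ CARD('n) * exp (- (z \<bullet> z) / N0)"
proof -
  have "noise_density N0 z = (\<Prod>i\<in>(UNIV :: 'n set). 1 / sqrt (pi * N0) * exp (- (z $ i)\<^sup>2 / N0))"
    using assms by (simp add: noise_density_def normal_density_def)
  also have "\<dots> = (1 / sqrt (pi * N0)) ^ CARD('n) * exp (\<Sum>i\<in>UNIV. - (z $ i)\<^sup>2 / N0)"
    unfolding prod.distrib by (simp add: exp_sum)
  also have "(\<Sum>i\<in>UNIV. - (z $ i)\<^sup>2 / N0) = - (z \<bullet> z) / N0"
    by (simp add: inner_vec_def power2_eq_square sum_negf sum_divide_distrib)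
  finally show ?thesis .
qed

lemma noise_density_pos: "0 < N0 \<Longrightarrow> 0 < noise_density N0 z"
  by (simp add: noise_density_eq_exp)

lemma noise_density_diff:
  assumes "0 < N0"
  shows "noise_density N0 (y - a) = noise_density N0 y * lik N0 a y"
  using assms
  by (simp add: noise_density_eq_exp lik_def exp_add[symmetric] inner_diff_left inner_diff_right
      inner_commute field_simps)

text \<open>Up to a constant factor, likelihood ratios are closed under products. Since each has
  mean 1 under the noise, every mixed moment below is an explicit exponential.\<close>

lemma lik_mult_lik: "lik N0 a y * lik N0 b y = exp (2 * (a \<bullet> b) / N0) * lik N0 (a + b) y"
  unfolding lik_def exp_add[symmetric] add_divide_distrib[symmetric]
  by (simp add: inner_add_left inner_add_right inner_commute algebra_simps)

text \<open>Change of measure from the shifted to the unshifted noise. It brings the outputs of all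
  symbols to one reference measure.\<close>

lemma integrable_noise_shift_iff:
  fixes f :: "real ^ 'n \<Rightarrow> real"
  assumes "0 < N0" and [measurable]: "f \<in> borel_measurable borel"
  shows "integrable (noise N0) (\<lambda>z. f (a + z)) \<longleftrightarrow> integrable (noise N0) (\<lambda>y. lik N0 a y * f y)"
proof -
  have "integrable (noise N0) (\<lambda>y. lik N0 a y * f y) \<longleftrightarrow>
      integrable (distr lborel borel ((+) a)) (\<lambda>y. noise_density N0 (y - a) * f y)"
    unfolding noise_def using assms
    by (subst integrable_density)
      (auto simp: noise_density_nonneg noise_density_diff lborel_distr_plus mult.assoc)
  also have "\<dots> \<longleftrightarrow> integrable lborel (\<lambda>z. noise_density N0 z * f (a + z))"
    by (subst integrable_distr_eq) auto
  also have "\<dots> \<longleftrightarrow> integrable (noise N0) (\<lambda>z. f (a + z))"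
    unfolding noise_def by (subst integrable_density) (auto simp: noise_density_nonneg)
  finally show ?thesis by simp
qed

lemma integral_noise_shift:
  fixes f :: "real ^ 'n \<Rightarrow> real"
  assumes "0 < N0" and [measurable]: "f \<in> borel_measurable borel"
  shows "(LINT z|noise N0. f (a + z)) = (LINT y|noise N0. lik N0 a y * f y)"
proof -
  have "(LINT y|noise N0. lik N0 a y * f y) =
      (LINT y|distr lborel borel ((+) a). noise_density N0 (y - a) * f y)"
    unfolding noise_def using assms
    by (subst integral_density)
      (auto simp: noise_density_nonneg noise_density_diff lborel_distr_plus mult.assoc)
  also have "\<dots> = (LINT z|lborel. noise_density N0 z * f (a + z))"
    by (subst integral_distr) auto
  also have "\<dots> = (LINT z|noise N0. f (a + z))"
    unfolding noise_def by (subst integral_density) (auto simp: noise_density_nonneg)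
  finally show ?thesis by simp
qed

context
  fixes N0 :: real
  assumes N0: "0 < N0"
begin

lemma has_bochner_integral_noise_one: "has_bochner_integral (noise N0 :: (real ^ 'n) measure) (\<lambda>_. 1 :: real) 1"
proof -
  interpret prob_space "noise N0 :: (real ^ 'n) measure"
    by (rule prob_space_noise[OF N0])
  show ?thesis using prob_space by (simp add: has_bochner_integral_iff)
qed

lemma has_bochner_integral_lik:
  fixes a :: "real ^ 'n"
  shows "has_bochner_integral (noise N0) (lik N0 a) 1"
  using integrable_noise_shift_iff[OF N0, of "\<lambda>_. 1" a] integral_noise_shift[OF N0, of "\<lambda>_. 1" a]
    has_bochner_integral_noise_one[where 'n = 'n]
  by (simp add: has_bochner_integral_iff)

lemma has_bochner_integral_lik2:
  "has_bochner_integral (noise N0) (\<lambda>y. lik N0 a y * lik N0 b y) (exp (2 * (a \<bullet> b) / N0))"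
  unfolding lik_mult_lik
  using has_bochner_integral_mult_right[OF has_bochner_integral_lik, of "exp (2 * (a \<bullet> b) / N0)" "a + b"]
  by simp

lemma has_bochner_integral_lik3:
  "has_bochner_integral (noise N0) (\<lambda>y. lik N0 a y * lik N0 b y * lik N0 c y)
     (exp (2 * (a \<bullet> b) / N0 + 2 * (a \<bullet> c) / N0 + 2 * (b \<bullet> c) / N0))"
  unfolding lik_mult_lik mult.assoc
  using has_bochner_integral_mult_right[OF has_bochner_integral_lik2, of "exp (2 * (a \<bullet> b) / N0)" "a + b" c]
  by (simp add: lik_mult_lik exp_add inner_add_left add_divide_distrib distrib_left mult.assoc)

lemma has_bochner_integral_lik_power4:
  "has_bochner_integral (noise N0) (\<lambda>y. lik N0 a y ^ 4) (exp (6 * (2 * (a \<bullet> a) / N0)))"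
proof -
  have "(lik N0 a y) ^ 4 = exp (2 * (2 * (a \<bullet> a) / N0)) * (lik N0 (a + a) y * lik N0 (a + a) y)" for y
  proof -
    have "(lik N0 a y) ^ 4 = (lik N0 a y * lik N0 a y) * (lik N0 a y * lik N0 a y)"
      by (simp add: power4_eq_xxxx)
    also have "\<dots> = exp (2 * (2 * (a \<bullet> a) / N0)) * (lik N0 (a + a) y * lik N0 (a + a) y)"
      unfolding lik_mult_lik[of N0 a y a] by (simp add: exp_add[symmetric])
    finally show ?thesis .
  qed
  moreover have inner_double: "(2 * a) \<bullet> (2 * a) = 4 * (a \<bullet> a)"
    by (simp only: mult_2 inner_add_left inner_add_right)
  ultimately show ?thesis
    using has_bochner_integral_mult_right[OF has_bochner_integral_lik2,
        of "exp (2 * (2 * (a \<bullet> a) / N0))" "a + a" "a + a"]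
    by (simp add: exp_add[symmetric] inner_double add_divide_distrib[symmetric])
qed

lemma has_bochner_integral_lik_centered2:
  "has_bochner_integral (noise N0) (\<lambda>y. (lik N0 a y - 1) * (lik N0 b y - 1)) (exp (2 * (a \<bullet> b) / N0) - 1)"
proof -
  have "(lik N0 a y - 1) * (lik N0 b y - 1) = lik N0 a y * lik N0 b y - lik N0 a y - lik N0 b y + 1"
    for y by (simp add: algebra_simps)
  then show ?thesis
    using has_bochner_integral_add[OF has_bochner_integral_diff[OF has_bochner_integral_diff[OF
      has_bochner_integral_lik2[of a b] has_bochner_integral_lik[of a]] has_bochner_integral_lik[of b]] has_bochner_integral_noise_one]
    by simp
qed

lemma has_bochner_integral_lik_centered3:
  "has_bochner_integral (noise N0) (\<lambda>y. (lik N0 a y - 1) * (lik N0 b y - 1) * (lik N0 c y - 1))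
     (exp (2 * (a \<bullet> b) / N0 + 2 * (a \<bullet> c) / N0 + 2 * (b \<bullet> c) / N0)
       - exp (2 * (a \<bullet> b) / N0) - exp (2 * (a \<bullet> c) / N0) - exp (2 * (b \<bullet> c) / N0) + 2)"
proof -
  have "(lik N0 a y - 1) * (lik N0 b y - 1) * (lik N0 c y - 1) =
      lik N0 a y * lik N0 b y * lik N0 c y - (lik N0 a y * lik N0 c y) - (lik N0 b y * lik N0 c y)
      + lik N0 c y - (lik N0 a y - 1) * (lik N0 b y - 1)"
    for y by (simp add: algebra_simps)
  then show ?thesis
    using has_bochner_integral_diff[OF has_bochner_integral_add[OF
      has_bochner_integral_diff[OF has_bochner_integral_diff[OF has_bochner_integral_lik3[of a b c]
        has_bochner_integral_lik2[of a c]] has_bochner_integral_lik2[of b c]]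
      has_bochner_integral_lik[of c]] has_bochner_integral_lik_centered2[of a b]]
    by (simp add: algebra_simps)
qed

lemma has_bochner_integral_lik_centered_power4:
  "has_bochner_integral (noise N0) (\<lambda>y. (lik N0 a y - 1) ^ 4)
     (exp (6 * (2 * (a \<bullet> a) / N0)) - 4 * exp (3 * (2 * (a \<bullet> a) / N0))
       + 6 * exp (2 * (a \<bullet> a) / N0) - 4 + 1)"
proof -
  have "(lik N0 a y - 1) ^ 4 =
      lik N0 a y ^ 4 - 4 * (lik N0 a y * lik N0 a y * lik N0 a y) + 6 * (lik N0 a y * lik N0 a y)
      - 4 * lik N0 a y + 1" for y
    by (simp add: algebra_simps power4_eq_xxxx)
  then show ?thesis
    using has_bochner_integral_add[OF has_bochner_integral_diff[OF has_bochner_integral_add[OF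
      has_bochner_integral_diff[OF has_bochner_integral_lik_power4[of a]
        has_bochner_integral_mult_right[OF has_bochner_integral_lik3[of a a a], of 4]]
        has_bochner_integral_mult_right[OF has_bochner_integral_lik2[of a a], of 6]]
        has_bochner_integral_mult_right[OF has_bochner_integral_lik[of a], of 4]] has_bochner_integral_noise_one]
    by simp
qed

end

section \<open>Means of likelihood ratios over a set of symbols\<close>

lemma abs_mean_le:
  fixes f :: "'i \<Rightarrow> real"
  assumes "\<And>i. i \<in> I \<Longrightarrow> \<bar>f i\<bar> \<le> B" "0 \<le> B"
  shows "\<bar>(\<Sum>i\<in>I. f i) / card I\<bar> \<le> B"
proof (cases "card I = 0")
  case False
  have "\<bar>\<Sum>i\<in>I. f i\<bar> \<le> card I * B"
    using sum_norm_bound[of I f B] assms by simp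
  then show ?thesis using False by (simp add: field_simps)
qed (use assms in simp)

text \<open>Cauchy-Schwarz applied twice. It reduces the fourth moment of a mean to fourth moments
  of single likelihood ratios, so that no mixed moment of four shifts has to be expanded.\<close>

lemma mean_power4_le:
  fixes f :: "'i \<Rightarrow> real"
  shows "((\<Sum>i\<in>I. f i) / card I) ^ 4 \<le> (\<Sum>i\<in>I. f i ^ 4) / card I"
proof (cases "card I = 0")
  case False
  let ?n = "real (card I)"
  have sq: "((\<Sum>i\<in>I. g i) / ?n)\<^sup>2 \<le> (\<Sum>i\<in>I. (g i)\<^sup>2) / ?n" for g :: "'i \<Rightarrow> real"
  proof -
    have "(\<Sum>i\<in>I. g i)\<^sup>2 \<le> (\<Sum>i\<in>I. (g i)\<^sup>2) * ?n"
      using sum_squared_le_sum_of_squares[of g I] by simp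
    then have "(\<Sum>i\<in>I. g i)\<^sup>2 / ?n\<^sup>2 \<le> ((\<Sum>i\<in>I. (g i)\<^sup>2) * ?n) / ?n\<^sup>2"
      by (rule divide_right_mono) simp
    with False show ?thesis by (simp add: power_divide power2_eq_square)
  qed
  have "((\<Sum>i\<in>I. f i) / ?n) ^ 4 = (((\<Sum>i\<in>I. f i) / ?n)\<^sup>2)\<^sup>2"
    by (simp flip: power_mult)
  also have "\<dots> \<le> ((\<Sum>i\<in>I. (f i)\<^sup>2) / ?n)\<^sup>2"
    using sq[of f] by (intro power_mono) auto
  also have "\<dots> \<le> (\<Sum>i\<in>I. ((f i)\<^sup>2)\<^sup>2) / ?n" by (rule sq)
  finally show ?thesis by (simp flip: power_mult)
qed simp

text \<open>For \<open>a i = h * x i\<close> this is the output density given the fading, divided by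
  the density of the noise alone. A subset \<open>I\<close> of the codewords gives the density
  conditioned on that subset.\<close>

definition mean_lik :: "real \<Rightarrow> 'i set \<Rightarrow> ('i \<Rightarrow> real ^ 'n) \<Rightarrow> real ^ 'n \<Rightarrow> real" where
  "mean_lik N0 I a y = (\<Sum>i\<in>I. lik N0 (a i) y) / card I"

lemma mean_lik_measurable [measurable]: "mean_lik N0 I a \<in> borel_measurable borel"
  unfolding mean_lik_def by measurable

lemma mean_lik_pos: "finite I \<Longrightarrow> I \<noteq> {} \<Longrightarrow> 0 < mean_lik N0 I a y"
  by (simp add: mean_lik_def divide_pos_pos sum_pos lik_pos card_gt_0_iff)

context
  fixes N0 :: real and I :: "'i set" and a :: "'i \<Rightarrow> real ^ 'n"
  assumes N0: "0 < N0" and fin: "finite I" and ne: "I \<noteq> {}"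
begin

private lemma mean_lik_minus_one: "mean_lik N0 I a y - 1 = (\<Sum>i\<in>I. lik N0 (a i) y - 1) / card I"
  using fin ne by (simp add: mean_lik_def sum_subtractf diff_divide_distrib)

lemma has_bochner_integral_mean_lik: "has_bochner_integral (noise N0) (mean_lik N0 I a) 1"
proof -
  have "has_bochner_integral (noise N0) (\<lambda>y. (\<Sum>i\<in>I. lik N0 (a i) y) / card I) ((\<Sum>i\<in>I. 1) / card I)"
    by (intro has_bochner_integral_divide has_bochner_integral_sum has_bochner_integral_lik N0)
  then show ?thesis
    using fin ne by (simp add: mean_lik_def[abs_def])
qed

lemma mean_lik_centered2:
  "has_bochner_integral (noise N0) (\<lambda>y. (mean_lik N0 I a y - 1)\<^sup>2)
     ((\<Sum>i\<in>I. (\<Sum>j\<in>I. exp (2 * (a i \<bullet> a j) / N0) - 1) / card I) / card I)"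
proof -
  have "has_bochner_integral (noise N0)
      (\<lambda>y. (\<Sum>i\<in>I. (\<Sum>j\<in>I. (lik N0 (a i) y - 1) * (lik N0 (a j) y - 1)) / card I) / card I)
      ((\<Sum>i\<in>I. (\<Sum>j\<in>I. exp (2 * (a i \<bullet> a j) / N0) - 1) / card I) / card I)"
    by (intro has_bochner_integral_divide has_bochner_integral_sum
        has_bochner_integral_lik_centered2 N0)
  moreover have "(mean_lik N0 I a y - 1)\<^sup>2 =
      (\<Sum>i\<in>I. (\<Sum>j\<in>I. (lik N0 (a i) y - 1) * (lik N0 (a j) y - 1)) / card I) / card I" for y
    by (simp add: mean_lik_minus_one power2_eq_square sum_product sum_divide_distrib)
  ultimately show ?thesis by simp
qed

lemma mean_lik_centered3:
  "has_bochner_integral (noise N0) (\<lambda>y. (mean_lik N0 I a y - 1) ^ 3)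
     ((\<Sum>i\<in>I. (\<Sum>j\<in>I. (\<Sum>k\<in>I.
        exp (2 * (a i \<bullet> a j) / N0 + 2 * (a i \<bullet> a k) / N0 + 2 * (a j \<bullet> a k) / N0)
         - exp (2 * (a i \<bullet> a j) / N0) - exp (2 * (a i \<bullet> a k) / N0) - exp (2 * (a j \<bullet> a k) / N0) + 2)
       / card I) / card I) / card I)"
    (is "has_bochner_integral _ _ ?r")
proof -
  have "has_bochner_integral (noise N0)
      (\<lambda>y. (\<Sum>i\<in>I. (\<Sum>j\<in>I. (\<Sum>k\<in>I. (lik N0 (a i) y - 1) * (lik N0 (a j) y - 1)
         * (lik N0 (a k) y - 1)) / card I) / card I) / card I) ?r"
    by (intro has_bochner_integral_divide has_bochner_integral_sum
        has_bochner_integral_lik_centered3 N0)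
  moreover have "(mean_lik N0 I a y - 1) ^ 3 =
      (\<Sum>i\<in>I. (\<Sum>j\<in>I. (\<Sum>k\<in>I. (lik N0 (a i) y - 1) * (lik N0 (a j) y - 1)
         * (lik N0 (a k) y - 1)) / card I) / card I) / card I" for y
    unfolding mean_lik_minus_one
    by (simp add: power3_eq_cube sum_divide_distrib sum_distrib_left sum_distrib_right mult.commute)
  ultimately show ?thesis by simp
qed

lemma
  shows integrable_mean_lik_power4: "integrable (noise N0) (\<lambda>y. (mean_lik N0 I a y - 1) ^ 4)"
    and integral_mean_lik_power4_le: "(LINT y|noise N0. (mean_lik N0 I a y - 1) ^ 4) \<le>
      (\<Sum>i\<in>I. exp (6 * (2 * (a i \<bullet> a i) / N0)) - 4 * exp (3 * (2 * (a i \<bullet> a i) / N0))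
         + 6 * exp (2 * (a i \<bullet> a i) / N0) - 4 + 1) / card I"
proof -
  have *: "has_bochner_integral (noise N0) (\<lambda>y. (\<Sum>i\<in>I. (lik N0 (a i) y - 1) ^ 4) / card I)
      ((\<Sum>i\<in>I. exp (6 * (2 * (a i \<bullet> a i) / N0)) - 4 * exp (3 * (2 * (a i \<bullet> a i) / N0))
         + 6 * exp (2 * (a i \<bullet> a i) / N0) - 4 + 1) / card I)"
    by (intro has_bochner_integral_divide has_bochner_integral_sum
        has_bochner_integral_lik_centered_power4 N0)
  have le: "(mean_lik N0 I a y - 1) ^ 4 \<le> (\<Sum>i\<in>I. (lik N0 (a i) y - 1) ^ 4) / card I" for y
    unfolding mean_lik_minus_one by (rule mean_power4_le)
  show int: "integrable (noise N0) (\<lambda>y. (mean_lik N0 I a y - 1) ^ 4)"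
    by (rule Bochner_Integration.integrable_bound[OF integrable.intros[OF *]])
      (use order_trans[OF le abs_ge_self] in auto)
  show "(LINT y|noise N0. (mean_lik N0 I a y - 1) ^ 4) \<le>
      (\<Sum>i\<in>I. exp (6 * (2 * (a i \<bullet> a i) / N0)) - 4 * exp (3 * (2 * (a i \<bullet> a i) / N0))
         + 6 * exp (2 * (a i \<bullet> a i) / N0) - 4 + 1) / card I"
    by (rule order_trans[OF integral_mono[OF int integrable.intros[OF *] le]
          eq_refl[OF has_bochner_integral_integral_eq[OF *]]])
qed

lemma
  shows integrable_entropy_mean_lik:
      "integrable (noise N0) (\<lambda>y. mean_lik N0 I a y * ln (mean_lik N0 I a y))"
    and integral_entropy_mean_lik_ge:
      "(LINT y|noise N0. (mean_lik N0 I a y - 1)\<^sup>2) / 2 - (LINT y|noise N0. (mean_lik N0 I a y - 1) ^ 3) / 6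
        \<le> (LINT y|noise N0. mean_lik N0 I a y * ln (mean_lik N0 I a y))"
    and integral_entropy_mean_lik_le:
      "(LINT y|noise N0. mean_lik N0 I a y * ln (mean_lik N0 I a y))
        \<le> (LINT y|noise N0. (mean_lik N0 I a y - 1)\<^sup>2) / 2 - (LINT y|noise N0. (mean_lik N0 I a y - 1) ^ 3) / 6
          + (LINT y|noise N0. (mean_lik N0 I a y - 1) ^ 4) / 3"
proof -
  let ?u = "mean_lik N0 I a"
  define T where "T = (\<lambda>y. (?u y - 1) + (?u y - 1)\<^sup>2 / 2 - (?u y - 1) ^ 3 / 6)"
  let ?E = "(LINT y|noise N0. (?u y - 1)\<^sup>2) / 2 - (LINT y|noise N0. (?u y - 1) ^ 3) / 6"
  \<comment> \<open>The linear term contributes \<open>1 - 1\<close>, because a mean likelihood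
    ratio integrates to 1.\<close>
  have "has_bochner_integral (noise N0) T ((1 - 1) + (LINT y|noise N0. (?u y - 1)\<^sup>2) / 2
      - (LINT y|noise N0. (?u y - 1) ^ 3) / 6)"
    unfolding T_def
    by (intro has_bochner_integral_add has_bochner_integral_diff has_bochner_integral_divide
        has_bochner_integral_mean_lik has_bochner_integral_noise_one N0 has_bochner_integral_integrable
        integrable.intros[OF mean_lik_centered2] integrable.intros[OF mean_lik_centered3])
  then have T: "has_bochner_integral (noise N0) T ?E" by simp
  have U: "has_bochner_integral (noise N0) (\<lambda>y. T y + (?u y - 1) ^ 4 / 3)
      (?E + (LINT y|noise N0. (?u y - 1) ^ 4) / 3)"
    by (intro has_bochner_integral_add has_bochner_integral_divide T
        has_bochner_integral_integrable integrable_mean_lik_power4)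
  have le: "?u y * ln (?u y) \<le> T y + (?u y - 1) ^ 4 / 3" and ge: "T y \<le> ?u y * ln (?u y)" for y
    using entropy_le_quartic[OF mean_lik_pos[OF fin ne]] entropy_ge_cubic[OF mean_lik_pos[OF fin ne]]
    unfolding T_def by auto
  show int: "integrable (noise N0) (\<lambda>y. ?u y * ln (?u y))"
  proof (rule Bochner_Integration.integrable_bound)
    show "integrable (noise N0) (\<lambda>y. \<bar>T y\<bar> + \<bar>T y + (?u y - 1) ^ 4 / 3\<bar>)"
      using integrable.intros[OF T] integrable.intros[OF U] by auto
    show "AE y in noise N0. norm (?u y * ln (?u y)) \<le> norm (\<bar>T y\<bar> + \<bar>T y + (?u y - 1) ^ 4 / 3\<bar>)"
    proof (rule AE_I2)
      fix y :: "real ^ 'n"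
      show "norm (?u y * ln (?u y)) \<le> norm (\<bar>T y\<bar> + \<bar>T y + (?u y - 1) ^ 4 / 3\<bar>)"
        unfolding real_norm_def using le[of y] ge[of y] by arith
    qed
  qed measurable
  show "?E \<le> (LINT y|noise N0. ?u y * ln (?u y))"
    using integral_mono[OF integrable.intros[OF T] int ge] has_bochner_integral_integral_eq[OF T] by simp
  show "(LINT y|noise N0. ?u y * ln (?u y)) \<le> ?E + (LINT y|noise N0. (?u y - 1) ^ 4) / 3"
    using integral_mono[OF int integrable.intros[OF U] le] has_bochner_integral_integral_eq[OF U] by simp
qed

text \<open>The first-order part of the second moment is \<open>2 * ?q\<close>, which gives the main
  term. In the third and fourth moments the constant and linear parts of the exponentials cancel,
  which leaves order \<open>s^2\<close>. The threshold 1/6 keeps the largest exponent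
  \<open>6 * p i i\<close> within the range of the quadratic bound on \<open>exp\<close>. The
  constant 29 rounds up \<open>1/2 + 12/6 + 78/3\<close>.\<close>

lemma integral_entropy_mean_lik_approx:
  assumes s: "\<And>i. i \<in> I \<Longrightarrow> 2 * (norm (a i))\<^sup>2 / N0 \<le> s" and "s \<le> 1 / 6"
  shows "\<bar>(LINT y|noise N0. mean_lik N0 I a y * ln (mean_lik N0 I a y))
     - (norm ((\<Sum>i\<in>I. a i) /\<^sub>R card I))\<^sup>2 / N0\<bar> \<le> 29 * s\<^sup>2"
proof -
  define p where "p = (\<lambda>i j. 2 * (a i \<bullet> a j) / N0)"
  have p_eq: "2 * (a i \<bullet> a j) / N0 = p i j" for i j
    by (simp add: p_def)
  have s0: "0 \<le> s"
    using ne s N0 by (force intro: order_trans[rotated])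
  have p: "\<bar>p i j\<bar> \<le> s" if "i \<in> I" "j \<in> I" for i j
  proof -
    have "\<bar>a i \<bullet> a j\<bar> \<le> norm (a i) * norm (a j)" by (rule Cauchy_Schwarz_ineq2)
    also have "\<dots> \<le> ((norm (a i))\<^sup>2 + (norm (a j))\<^sup>2) / 2"
      using sum_squares_bound[of "norm (a i)" "norm (a j)"] by simp
    also have "\<dots> \<le> N0 * s / 2"
      using s[OF that(1)] s[OF that(2)] N0 by (simp add: field_simps)
    finally have "\<bar>a i \<bullet> a j\<bar> \<le> N0 * s / 2" .
    then show ?thesis using N0 by (simp add: p_def abs_mult field_simps)
  qed
  have e: "\<bar>exp x - 1 - x\<bar> \<le> c\<^sup>2 * s\<^sup>2" if "\<bar>x\<bar> \<le> c * s" "0 \<le> c" "c \<le> 6" for c x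
  proof -
    have "c * s \<le> 6 * (1 / 6)" using that s0 assms(2) by (intro mult_mono) auto
    then have "\<bar>exp x - 1 - x\<bar> \<le> x\<^sup>2" using that by (intro abs_exp_minus_linear_le) auto
    also have "\<dots> \<le> (c * s)\<^sup>2" using that by (metis abs_ge_zero power2_abs power_mono)
    finally show ?thesis by (simp add: power_mult_distrib)
  qed
  let ?m = "\<lambda>f. (\<Sum>i\<in>I. f i) / real (card I)"
  let ?q = "(norm ((\<Sum>i\<in>I. a i) /\<^sub>R card I))\<^sup>2 / N0"
  have E2: "\<bar>?m (\<lambda>i. ?m (\<lambda>j. exp (p i j) - 1)) - 2 * ?q\<bar> \<le> s\<^sup>2"
  proof -
    have "?m (\<lambda>i. ?m (\<lambda>j. p i j)) = 2 * ?q"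
      unfolding p_def power2_norm_eq_inner
      by (simp add: inner_sum_left inner_sum_right sum_divide_distrib sum_distrib_left
          divide_inverse mult_ac inner_commute)
    then have "?m (\<lambda>i. ?m (\<lambda>j. exp (p i j) - 1)) - 2 * ?q = ?m (\<lambda>i. ?m (\<lambda>j. exp (p i j) - 1 - p i j))"
      by (simp add: sum_subtractf diff_divide_distrib)
    moreover have "\<bar>?m (\<lambda>i. ?m (\<lambda>j. exp (p i j) - 1 - p i j))\<bar> \<le> s\<^sup>2"
      by (intro abs_mean_le) (use e[of _ 1] p in auto)
    ultimately show ?thesis by simp
  qed
  \<comment> \<open>Only the quadratic errors remain: \<open>3^2\<close> for the triple exponent and
    1 for each of the three others.\<close>
  have E3: "\<bar>?m (\<lambda>i. ?m (\<lambda>j. ?m (\<lambda>k. exp (p i j + p i k + p j k) - exp (p i j) - exp (p i k) - exp (p j k) + 2)))\<bar>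
      \<le> 12 * s\<^sup>2"
  proof (intro abs_mean_le)
    fix i j k assume ijk: "i \<in> I" "j \<in> I" "k \<in> I"
    note b = p[OF ijk(1,2)] p[OF ijk(1,3)] p[OF ijk(2,3)]
    have "\<bar>exp (p i j + p i k + p j k) - 1 - (p i j + p i k + p j k)\<bar> \<le> 3\<^sup>2 * s\<^sup>2"
      by (rule e) (use b in arith, simp_all)
    with e[of "p i j" 1] e[of "p i k" 1] e[of "p j k" 1] b
    show "\<bar>exp (p i j + p i k + p j k) - exp (p i j) - exp (p i k) - exp (p j k) + 2\<bar> \<le> 12 * s\<^sup>2"
      by simp
  qed auto
  \<comment> \<open>The linear coefficients \<open>6 - 4 * 3 + 6\<close> cancel; the errors add up
    to \<open>6^2 + 4 * 3^2 + 6 = 78\<close>.\<close>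
  have E4: "?m (\<lambda>i. exp (6 * p i i) - 4 * exp (3 * p i i) + 6 * exp (p i i) - 4 + 1) \<le> 78 * s\<^sup>2"
  proof (rule order_trans[OF abs_ge_self abs_mean_le])
    fix i assume i: "i \<in> I"
    show "\<bar>exp (6 * p i i) - 4 * exp (3 * p i i) + 6 * exp (p i i) - 4 + 1\<bar> \<le> 78 * s\<^sup>2"
      using e[of "6 * p i i" 6] e[of "3 * p i i" 3] e[of "p i i" 1] p[OF i i]
      by (simp add: abs_mult)
  qed simp
  have combine: "\<bar>J - q\<bar> \<le> 29 * t"
    if "J2 / 2 - J3 / 6 \<le> J" "J \<le> J2 / 2 - J3 / 6 + J4 / 3" "J4 \<le> K" "\<bar>J2 - 2 * q\<bar> \<le> t"
      "\<bar>J3\<bar> \<le> 12 * t" "K \<le> 78 * t" for J J2 J3 J4 K q t :: real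
    using that by linarith
  note I2 = has_bochner_integral_integral_eq[OF mean_lik_centered2, unfolded p_eq]
  note I3 = has_bochner_integral_integral_eq[OF mean_lik_centered3, unfolded p_eq]
  show ?thesis
    by (rule combine[OF integral_entropy_mean_lik_ge[unfolded I2 I3]
          integral_entropy_mean_lik_le[unfolded I2 I3] integral_mean_lik_power4_le[unfolded p_eq] E2 E3 E4])
qed

end

section \<open>Information carried by one bit\<close>

lemma norm_mean_le:
  fixes a :: "'i \<Rightarrow> 'v :: real_normed_vector"
  assumes "\<And>i. i \<in> I \<Longrightarrow> norm (a i) \<le> r" "0 \<le> r"
  shows "norm ((\<Sum>i\<in>I. a i) /\<^sub>R card I) \<le> r"
proof (cases "card I = 0")
  case False
  have "norm (\<Sum>i\<in>I. a i) \<le> card I * r"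
    using sum_norm_bound[of I a r] assms by simp
  then show ?thesis using False by (simp add: field_simps)
qed (use assms in simp)

text \<open>The relative entropy, in nats, of the uniform mixture of the shifted noise laws with
  respect to the unshifted one.\<close>

definition entropy_mean_lik :: "real \<Rightarrow> 'i set \<Rightarrow> ('i \<Rightarrow> real ^ 'n) \<Rightarrow> real" where
  "entropy_mean_lik N0 I a = (LINT y|noise N0. mean_lik N0 I a y * ln (mean_lik N0 I a y))"

text \<open>
  A uniform index \<open>i\<close> carries the bit \<open>\<beta> i\<close>, and \<open>z\<close> is the noise added to \<open>a i\<close>.
\<close>

definition bit_log_ratio ::
  "real \<Rightarrow> 'i set \<Rightarrow> ('i \<Rightarrow> bool) \<Rightarrow> ('i \<Rightarrow> real ^ 'n) \<Rightarrow> 'i \<Rightarrow> real ^ 'n \<Rightarrow> real" where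
  "bit_log_ratio N0 I \<beta> a i z =
     ln (mean_lik N0 {j \<in> I. \<beta> j = \<beta> i} a (a i + z) / mean_lik N0 I a (a i + z))"

context
  fixes N0 :: real and I :: "'i set" and a :: "'i \<Rightarrow> real ^ 'n" and \<beta> :: "'i \<Rightarrow> bool"
  assumes N0: "0 < N0" and fin: "finite I" and ne: "I \<noteq> {}"
    and balanced: "\<And>b. 2 * card {i \<in> I. \<beta> i = b} = card I"
begin

private abbreviation half :: "bool \<Rightarrow> 'i set" where "half b \<equiv> {i \<in> I. \<beta> i = b}"

private lemma half: "finite (half b)" "half b \<noteq> {}" "card (half b) > 0" "half b \<subseteq> I"
    "real (card I) = 2 * real (card (half b))"
proof -
  show "finite (half b)" "half b \<subseteq> I" using fin by auto
  have "card I > 0" using fin ne by (simp add: card_gt_0_iff)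
  then show "card (half b) > 0" using balanced[of b] by simp
  then show "half b \<noteq> {}" using card_gt_0_iff by blast
  show "real (card I) = 2 * real (card (half b))" using balanced[of b] by (metis of_nat_mult of_nat_numeral)
qed

private lemma sum_halves: "(\<Sum>i\<in>I. f i) = (\<Sum>i\<in>half True. f i) + (\<Sum>i\<in>half False. f i)"
  for f :: "'i \<Rightarrow> 'c :: comm_monoid_add"
proof -
  have "I = half True \<union> half False" by auto
  then have "sum f I = sum f (half True \<union> half False)" by simp
  also have "\<dots> = sum f (half True) + sum f (half False)"
    using fin by (intro sum.union_disjoint) auto
  finally show ?thesis .
qed

private lemma mean_halves:
  "mean_lik N0 I a y = (mean_lik N0 (half True) a y + mean_lik N0 (half False) a y) / 2"
  using half(5)[of True] half(5)[of False]
  by (simp add: mean_lik_def sum_halves[of "\<lambda>i. lik N0 (a i) y"] add_divide_distrib)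

private lemma mean_half_le: "mean_lik N0 (half b) a y \<le> 2 * mean_lik N0 I a y"
  using mean_lik_pos[OF half(1,2), of N0 True a y] mean_lik_pos[OF half(1,2), of N0 False a y]
  by (cases b) (simp_all add: mean_halves)

text \<open>One likelihood ratio is at most \<open>card B\<close> times the mean over
  \<open>B\<close>, so the integrability of \<open>u ln u\<close> at that mean dominates.\<close>

private lemma ln_mean_lik_integral:
  assumes "finite B" "i \<in> B"
  shows "integrable (noise N0) (\<lambda>y. lik N0 (a i) y * ln (mean_lik N0 B a y))"
proof (rule Bochner_Integration.integrable_bound)
  have B: "B \<noteq> {}" "card B > 0" using assms by (auto simp: card_gt_0_iff)
  show "integrable (noise N0) (\<lambda>y. card B * (mean_lik N0 B a y * ln (mean_lik N0 B a y)))"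
    by (intro integrable_mult_right integrable_entropy_mean_lik N0 assms(1) B)
  have "lik N0 (a i) y \<le> card B * mean_lik N0 B a y" for y
    using B member_le_sum[OF assms(2), of "\<lambda>i. lik N0 (a i) y"] assms(1)
    by (simp add: mean_lik_def less_imp_le[OF lik_pos])
  then have "lik N0 (a i) y * \<bar>ln (mean_lik N0 B a y)\<bar> \<le> (card B * mean_lik N0 B a y) * \<bar>ln (mean_lik N0 B a y)\<bar>" for y
    by (intro mult_right_mono) auto
  then show "AE y in noise N0. norm (lik N0 (a i) y * ln (mean_lik N0 B a y)) \<le>
      norm (card B * (mean_lik N0 B a y * ln (mean_lik N0 B a y)))"
    using lik_pos[of N0 "a i"] mean_lik_pos[OF assms(1) B(1), of N0 a]
    by (intro AE_I2) (simp add: abs_mult abs_of_pos mult.assoc)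
qed measurable

private lemma bit_log_ratio_eq:
  "ln (mean_lik N0 (half b) a y / mean_lik N0 I a y) =
     ln (mean_lik N0 (half b) a y) - ln (mean_lik N0 I a y)"
  using mean_lik_pos[OF half(1,2), of N0 b a y] mean_lik_pos[OF fin ne, of N0 a y]
  by (simp add: ln_div)

private lemma integrable_lik_log_ratio:
  assumes "i \<in> I"
  shows "integrable (noise N0) (\<lambda>y. lik N0 (a i) y * ln (mean_lik N0 (half (\<beta> i)) a y / mean_lik N0 I a y))"
  unfolding bit_log_ratio_eq right_diff_distrib
  by (intro Bochner_Integration.integrable_diff ln_mean_lik_integral) (use assms fin in auto)

lemma integrable_bit_log_ratio:
  assumes "i \<in> I"
  shows "integrable (noise N0) (bit_log_ratio N0 I \<beta> a i)"
  unfolding bit_log_ratio_def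
  by (subst integrable_noise_shift_iff[OF N0,
        of "\<lambda>y. ln (mean_lik N0 (half (\<beta> i)) a y / mean_lik N0 I a y)"])
    (use integrable_lik_log_ratio[OF assms] in auto)

text \<open>The logarithm depends on \<open>i\<close> only through \<open>\<beta> i\<close>, so each
  half of the sum collapses to a mean likelihood ratio times a logarithm.\<close>

private lemma lik_log_ratio_sum:
  "(\<Sum>i\<in>I. lik N0 (a i) y * ln (mean_lik N0 (half (\<beta> i)) a y / mean_lik N0 I a y)) / card I =
     (mean_lik N0 (half True) a y * ln (mean_lik N0 (half True) a y / mean_lik N0 I a y)
      + mean_lik N0 (half False) a y * ln (mean_lik N0 (half False) a y / mean_lik N0 I a y)) / 2"
proof -
  have *: "(\<Sum>i\<in>half b. lik N0 (a i) y * ln (mean_lik N0 (half (\<beta> i)) a y / mean_lik N0 I a y)) / card I =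
      mean_lik N0 (half b) a y * ln (mean_lik N0 (half b) a y / mean_lik N0 I a y) / 2" for b
  proof -
    have "(\<Sum>i\<in>half b. lik N0 (a i) y * ln (mean_lik N0 (half (\<beta> i)) a y / mean_lik N0 I a y)) =
        (\<Sum>i\<in>half b. lik N0 (a i) y) * ln (mean_lik N0 (half b) a y / mean_lik N0 I a y)"
      unfolding sum_distrib_right by (rule sum.cong) auto
    then show ?thesis by (simp add: half(5)[of b] mean_lik_def)
  qed
  show ?thesis
    by (subst sum_halves) (simp only: add_divide_distrib *)
qed

lemma mean_integral_bit_log_ratio_eq:
  "(\<Sum>i\<in>I. LINT z|noise N0. bit_log_ratio N0 I \<beta> a i z) / card I =
     (LINT y|noise N0. (\<Sum>i\<in>I. lik N0 (a i) y * ln (mean_lik N0 (half (\<beta> i)) a y / mean_lik N0 I a y)) / card I)"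
proof -
  have "(LINT z|noise N0. bit_log_ratio N0 I \<beta> a i z) =
      (LINT y|noise N0. lik N0 (a i) y * ln (mean_lik N0 (half (\<beta> i)) a y / mean_lik N0 I a y))" for i
    unfolding bit_log_ratio_def
    by (rule integral_noise_shift[OF N0, of "\<lambda>y. ln (mean_lik N0 (half (\<beta> i)) a y / mean_lik N0 I a y)"])
      measurable
  then show ?thesis
    by (simp add: integrable_lik_log_ratio)
qed

text \<open>The halves have equal size, so their mean likelihood ratios average to that of
  \<open>I\<close>, and the terms with \<open>ln (mean_lik N0 I a y)\<close> recombine. The result
  is a difference of relative entropies to the common reference law.\<close>

lemma mean_integral_bit_log_ratio:
  "(\<Sum>i\<in>I. LINT z|noise N0. bit_log_ratio N0 I \<beta> a i z) / card I =
     (entropy_mean_lik N0 {i \<in> I. \<beta> i} a + entropy_mean_lik N0 {i \<in> I. \<not> \<beta> i} a) / 2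
      - entropy_mean_lik N0 I a"
proof -
  have "(\<Sum>i\<in>I. lik N0 (a i) y * ln (mean_lik N0 (half (\<beta> i)) a y / mean_lik N0 I a y)) / card I =
      (mean_lik N0 (half True) a y * ln (mean_lik N0 (half True) a y)
       + mean_lik N0 (half False) a y * ln (mean_lik N0 (half False) a y)) / 2
      - mean_lik N0 I a y * ln (mean_lik N0 I a y)" for y
  proof -
    have halves: "mean_lik N0 I a y * t =
        (mean_lik N0 (half True) a y * t + mean_lik N0 (half False) a y * t) / 2" for t
      by (simp add: mean_halves algebra_simps)
    show ?thesis
      unfolding lik_log_ratio_sum
      unfolding bit_log_ratio_eq halves[of "ln (mean_lik N0 I a y)"]
      by (simp add: algebra_simps add_divide_distrib diff_divide_distrib)
  qed
  moreover have "integrable (noise N0) (\<lambda>y. mean_lik N0 (half b) a y * ln (mean_lik N0 (half b) a y))" for b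
    by (rule integrable_entropy_mean_lik[OF N0 half(1,2)])
  note this[of True] this[of False]
  ultimately show ?thesis
    unfolding mean_integral_bit_log_ratio_eq
    by (simp add: entropy_mean_lik_def integrable_entropy_mean_lik[OF N0 fin ne])
qed

text \<open>Gibbs' inequality: the logarithm gives the lower bound \<open>?v b - ?u\<close> for each
  half, and these two bounds cancel because \<open>?u\<close> is the average of
  \<open>?v True\<close> and \<open>?v False\<close>.\<close>

lemma mean_integral_bit_log_ratio_nonneg:
  "0 \<le> (\<Sum>i\<in>I. LINT z|noise N0. bit_log_ratio N0 I \<beta> a i z) / card I"
  unfolding mean_integral_bit_log_ratio_eq
proof (rule integral_nonneg_AE, rule AE_I2)
  fix y :: "real ^ 'n"
  let ?u = "mean_lik N0 I a y" and ?v = "\<lambda>b. mean_lik N0 (half b) a y"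
  have "?v b - ?u \<le> ?v b * ln (?v b / ?u)" for b
  proof -
    have pos: "0 < ?v b" "0 < ?u"
      using mean_lik_pos[OF half(1,2), of N0 b a y] mean_lik_pos[OF fin ne, of N0 a y] by auto
    have "ln (?u / ?v b) \<le> ?u / ?v b - 1" using pos by (intro ln_le_minus_one) auto
    then have "?v b * ln (?u / ?v b) \<le> ?v b * (?u / ?v b - 1)" using pos by (intro mult_left_mono) auto
    moreover have "?v b * (?u / ?v b - 1) = ?u - ?v b" using pos by (simp add: right_diff_distrib)
    ultimately show ?thesis using pos by (simp add: ln_div right_diff_distrib)
  qed
  from add_mono[OF this[of True] this[of False]]
  have "0 \<le> ?v True * ln (?v True / ?u) + ?v False * ln (?v False / ?u)"
    by (rule order_trans[rotated]) (simp add: mean_halves)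
  then show "0 \<le> (\<Sum>i\<in>I. lik N0 (a i) y * ln (mean_lik N0 (half (\<beta> i)) a y / ?u)) / card I"
    unfolding lik_log_ratio_sum by simp
qed

text \<open>A half has at most twice the mean likelihood ratio of the whole, since the other half
  contributes a positive amount.\<close>

lemma bit_log_ratio_le: "bit_log_ratio N0 I \<beta> a i z \<le> ln 2"
proof -
  let ?u = "mean_lik N0 I a (a i + z)" and ?v = "mean_lik N0 (half (\<beta> i)) a (a i + z)"
  have pos: "0 < ?v" "0 < ?u"
    using mean_lik_pos[OF half(1,2)] mean_lik_pos[OF fin ne] by auto
  have "ln (?v / ?u) \<le> ln 2"
    using pos mean_half_le[of "\<beta> i" "a i + z"] by (subst ln_le_cancel_iff) (auto simp: field_simps)
  then show ?thesis by (simp add: bit_log_ratio_def)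
qed

lemma mean_integral_bit_log_ratio_le:
  "(\<Sum>i\<in>I. LINT z|noise N0. bit_log_ratio N0 I \<beta> a i z) / card I \<le> ln 2"
proof -
  interpret prob_space "noise N0 :: (real ^ 'n) measure" by (rule prob_space_noise[OF N0])
  have "(LINT z|noise N0. bit_log_ratio N0 I \<beta> a i z) \<le> ln 2" if "i \<in> I" for i
    by (rule integral_le_const[OF integrable_bit_log_ratio[OF that]]) (simp add: bit_log_ratio_le)
  then have "(\<Sum>i\<in>I. LINT z|noise N0. bit_log_ratio N0 I \<beta> a i z) \<le> card I * ln 2"
    by (rule sum_bounded_above)
  then show ?thesis using fin ne by (simp add: field_simps card_gt_0_iff)
qed

text \<open>
  The log ratio is bounded above, so the mean of its absolute value is controlled by its mean.
\<close>

lemma integral_abs_bit_log_ratio_le: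
  assumes "i \<in> I"
  shows "(LINT z|noise N0. \<bar>bit_log_ratio N0 I \<beta> a i z\<bar>) \<le> 2 * ln 2 * card I"
proof -
  interpret prob_space "noise N0 :: (real ^ 'n) measure" by (rule prob_space_noise[OF N0])
  let ?f = "bit_log_ratio N0 I \<beta> a"
  have abs_le: "(LINT z|noise N0. \<bar>?f j z\<bar>) \<le> 2 * ln 2 - (LINT z|noise N0. ?f j z)" if "j \<in> I" for j
  proof -
    have "\<bar>?f j z\<bar> \<le> 2 * ln 2 - ?f j z" for z
      using bit_log_ratio_le[of j z] ln_ge_zero[of "2 :: real"] unfolding abs_le_iff by linarith
    then have "(LINT z|noise N0. \<bar>?f j z\<bar>) \<le> (LINT z|noise N0. 2 * ln 2 - ?f j z)"
      using integrable_bit_log_ratio[OF that] by (intro integral_mono) auto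
    then show ?thesis using integrable_bit_log_ratio[OF that] prob_space by simp
  qed
  have "(LINT z|noise N0. \<bar>?f i z\<bar>) \<le> (\<Sum>j\<in>I. LINT z|noise N0. \<bar>?f j z\<bar>)"
    by (rule member_le_sum[OF assms]) (use fin in auto)
  also have "\<dots> \<le> (\<Sum>j\<in>I. 2 * ln 2 - (LINT z|noise N0. ?f j z))"
    by (rule sum_mono[OF abs_le])
  also have "\<dots> \<le> 2 * ln 2 * card I"
    using mean_integral_bit_log_ratio_nonneg fin ne
    by (simp add: sum_subtractf zero_le_divide_iff card_gt_0_iff)
  finally show ?thesis .
qed

text \<open>There is no smallness condition on \<open>s\<close>, because the estimate is later
  integrated over all fading values. For \<open>s\<close> up to 1/6 the three entropies contribute
  \<open>29 + 29\<close>, in units of \<open>s^2\<close>. Beyond that, the information is at most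
  \<open>ln 2\<close> and the main term at most \<open>s / 2\<close>, and both are absorbed by
  \<open>60 * s^2\<close>.\<close>

lemma mean_integral_bit_log_ratio_approx:
  assumes s: "\<And>i. i \<in> I \<Longrightarrow> 2 * (norm (a i))\<^sup>2 / N0 \<le> s"
  defines "A \<equiv> \<lambda>B. (\<Sum>i\<in>B. a i) /\<^sub>R card B"
  shows "\<bar>(\<Sum>i\<in>I. LINT z|noise N0. bit_log_ratio N0 I \<beta> a i z) / card I
     - (norm (A {i \<in> I. \<beta> i} - A {i \<in> I. \<not> \<beta> i}))\<^sup>2 / (4 * N0)\<bar> \<le> 60 * s\<^sup>2"
    (is "\<bar>?F - ?q\<bar> \<le> _")
proof -
  have s0: "0 \<le> s" using ne s N0 by (force intro: order_trans[rotated])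
  have AI: "A I = (1 / 2) *\<^sub>R (A (half True) + A (half False))"
    using half(5)[of True] half(5)[of False]
    by (simp add: A_def sum_halves[of a] scaleR_add_right)
  \<comment> \<open>Parallelogram law: the average of two squared norms exceeds the squared norm of
    the average by a quarter of the squared distance.\<close>
  have q: "?q = ((norm (A (half True)))\<^sup>2 / N0 + (norm (A (half False)))\<^sup>2 / N0) / 2 - (norm (A I))\<^sup>2 / N0"
    unfolding AI using N0
    by (simp add: power2_norm_eq_inner inner_add_left inner_add_right inner_diff_left
        inner_diff_right inner_commute field_simps)
  show ?thesis
  proof (cases "s \<le> 1 / 6")
    case True
    have "\<bar>entropy_mean_lik N0 (half b) a - (norm (A (half b)))\<^sup>2 / N0\<bar> \<le> 29 * s\<^sup>2" for b
      unfolding entropy_mean_lik_def A_def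
      by (rule integral_entropy_mean_lik_approx[OF N0 half(1,2) s True]) (use half(4) in auto)
    note this[of True, simplified] this[of False, simplified]
    moreover have "\<bar>entropy_mean_lik N0 I a - (norm (A I))\<^sup>2 / N0\<bar> \<le> 29 * s\<^sup>2"
      unfolding entropy_mean_lik_def A_def
      by (rule integral_entropy_mean_lik_approx[OF N0 fin ne s True])
    moreover have "\<bar>(eT + eF) / 2 - e - ((qT + qF) / 2 - q)\<bar> \<le> 60 * t"
      if "\<bar>eT - qT\<bar> \<le> 29 * t" "\<bar>eF - qF\<bar> \<le> 29 * t" "\<bar>e - q\<bar> \<le> 29 * t" for eT eF e qT qF q t :: real
      using that by (simp add: abs_le_iff field_simps)
    ultimately show ?thesis
      unfolding mean_integral_bit_log_ratio q by simp
  next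
    case False
    have r: "norm (a i) \<le> sqrt (N0 * s / 2)" if "i \<in> I" for i
    proof (rule real_le_rsqrt)
      show "(norm (a i))\<^sup>2 \<le> N0 * s / 2"
        using s[OF that] N0 by (simp add: pos_divide_le_eq mult.commute)
    qed
    have "norm (A (half b)) \<le> sqrt (N0 * s / 2)" for b
      unfolding A_def by (rule norm_mean_le) (use r half(4) s0 N0 in auto)
    from add_mono[OF this[of True] this[of False]]
    have "norm (A (half True) - A (half False)) \<le> 2 * sqrt (N0 * s / 2)"
      unfolding mult_2 by (rule order_trans[OF norm_triangle_ineq4])
    then have "(norm (A (half True) - A (half False)))\<^sup>2 \<le> (2 * sqrt (N0 * s / 2))\<^sup>2"
      by (intro power_mono) auto
    also have "\<dots> = 2 * N0 * s"
      using s0 N0 by (simp add: power_mult_distrib)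
    finally have "?q \<le> s / 2" using N0 by (simp add: pos_divide_le_eq mult_ac)
    moreover have "0 \<le> ?q" using N0 by simp
    moreover have "ln 2 \<le> (1 :: real)" using ln_le_minus_one[of "2 :: real"] by simp
    ultimately have "\<bar>?F - ?q\<bar> \<le> 1 + s"
      using mean_integral_bit_log_ratio_nonneg mean_integral_bit_log_ratio_le s0
      by linarith
    \<comment> \<open>From \<open>1 \<le> 6 * s\<close> follow \<open>1 \<le> 36 * s^2\<close> and
      \<open>s \<le> 6 * s^2\<close>.\<close>
    moreover have "1 + s \<le> 60 * s\<^sup>2"
    proof -
      have "1 \<le> 6 * s" using False by simp
      then have "1 * 1 \<le> (6 * s) * (6 * s)" by (intro mult_mono) auto
      moreover have "1 * s \<le> (6 * s) * s" using \<open>1 \<le> 6 * s\<close> s0 by (intro mult_right_mono) auto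
      ultimately show ?thesis using s0 by (simp add: power2_eq_square)
    qed
    ultimately show ?thesis by linarith
  qed
qed

end

section \<open>Expansion of the BICM capacity\<close>

definition codewords :: "nat \<Rightarrow> bool list set" where
  "codewords m = {c. length c = m}"

lemma in_codewords: "c \<in> codewords m \<longleftrightarrow> length c = m"
  by (simp add: codewords_def)

lemma finite_codewords [simp]: "finite (codewords m)"
  using finite_lists_length_eq[of "UNIV :: bool set" m] by (simp add: codewords_def)

lemma card_codewords: "card (codewords m) = 2 ^ m"
  using card_lists_length_eq[of "UNIV :: bool set" m] by (simp add: codewords_def)

lemma codewords_nonempty [simp]: "codewords m \<noteq> {}"
  by (metis Ex_list_of_length empty_iff in_codewords)

lemma code_bits_eq: "code_bits m = pmf_of_set (codewords m)"
proof (induction m)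
  case 0
  have "codewords 0 = {[]}" by (auto simp: codewords_def)
  then show ?case by (simp add: code_bits_def pmf_of_set_singleton)
next
  case (Suc m)
  let ?P = "pair_pmf (pmf_of_set (UNIV :: bool set)) (pmf_of_set (codewords m))"
  have code_bits: "code_bits (Suc m) = map_pmf (\<lambda>(x, xs). x # xs) ?P"
    using Suc by (simp add: code_bits_def bernoulli_pmf_half_conv_pmf_of_set pair_pmf_def map_bind_pmf)
  show ?case
  proof (rule pmf_eqI)
    fix c :: "bool list"
    show "pmf (code_bits (Suc m)) c = pmf (pmf_of_set (codewords (Suc m))) c"
    proof (cases c)
      case Nil
      have "pmf (map_pmf (\<lambda>(x, xs). x # xs) ?P) [] = 0" by (subst pmf_eq_0_set_pmf) auto
      then show ?thesis using Nil by (simp add: code_bits in_codewords)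
    next
      case (Cons x xs)
      have "pmf (map_pmf (\<lambda>(x, xs). x # xs) ?P) ((\<lambda>(x, xs). x # xs) (x, xs)) = pmf ?P (x, xs)"
        by (rule pmf_map_inj'[of "\<lambda>(x, xs). x # xs" ?P "(x, xs)"]) (auto simp: inj_def)
      then show ?thesis
        by (simp add: Cons code_bits in_codewords pmf_pair card_codewords indicator_def)
    qed
  qed
qed

lemma finite_bit_class: "finite {c \<in> codewords m. P c}"
  by (rule finite_subset[OF _ finite_codewords[of m]]) auto

text \<open>Flipping bit \<open>k\<close> is an involution that exchanges the two classes.\<close>

lemma card_codewords_bit:
  assumes "k < m"
  shows "2 * card {c \<in> codewords m. c ! k = b} = card (codewords m)"
proof -
  let ?f = "\<lambda>c :: bool list. c[k := \<not> c ! k]"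
  have inv: "?f (?f c) = c" if "k < length c" for c using that by simp
  have "bij_betw ?f {c \<in> codewords m. c ! k = b} {c \<in> codewords m. c ! k = (\<not> b)}"
  proof (rule bij_betw_byWitness[of _ ?f])
    show "\<forall>c\<in>{c \<in> codewords m. c ! k = b}. ?f (?f c) = c"
      "\<forall>c\<in>{c \<in> codewords m. c ! k = (\<not> b)}. ?f (?f c) = c"
      by (intro ballI inv; use assms in \<open>simp add: in_codewords\<close>)+
  qed (use assms in \<open>auto simp: in_codewords\<close>)
  then have "card {c \<in> codewords m. c ! k = b} = card {c \<in> codewords m. c ! k = (\<not> b)}"
    by (rule bij_betw_same_card)
  moreover have "codewords m = {c \<in> codewords m. c ! k = b} \<union> {c \<in> codewords m. c ! k = (\<not> b)}"
    by auto
  then have "card (codewords m) = card ({c \<in> codewords m. c ! k = b} \<union> {c \<in> codewords m. c ! k = (\<not> b)})"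
    by (rule arg_cong)
  then have "card (codewords m) = card {c \<in> codewords m. c ! k = b} + card {c \<in> codewords m. c ! k = (\<not> b)}"
    by (subst (asm) card_Un_disjoint) (auto intro: finite_bit_class)
  ultimately show ?thesis by simp
qed

lemma bit_class_nonempty:
  assumes "k < m"
  shows "{c \<in> codewords m. c ! k = b} \<noteq> {}"
proof -
  have "0 < card {c \<in> codewords m. c ! k = b}"
    using card_codewords_bit[OF assms, of b] card_codewords[of m] by (intro gr0I) auto
  then show ?thesis using card_gt_0_iff by blast
qed

lemma cond_code_bits_eq:
  assumes "k < m"
  shows "cond_pmf (code_bits m) {c. c ! k = b} = pmf_of_set {c \<in> codewords m. c ! k = b}"
proof (rule pmf_eqI)
  fix c
  let ?B = "{c \<in> codewords m. c ! k = b}"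
  have B: "?B \<noteq> {}" "finite ?B" "card ?B \<noteq> 0"
    using bit_class_nonempty[OF assms, of b] finite_bit_class[of m "\<lambda>c. c ! k = b"]
    by (simp_all del: Collect_empty_eq)
  have card: "real (card (codewords m)) = 2 * real (card ?B)"
    using arg_cong[OF card_codewords_bit[OF assms, of b], of real] by simp
  have Int: "codewords m \<inter> {c. c ! k = b} = ?B" by auto
  have ne: "set_pmf (code_bits m) \<inter> {c. c ! k = b} \<noteq> {}"
    unfolding code_bits_eq set_pmf_of_set[OF codewords_nonempty finite_codewords] Int by (rule B)
  have half: "measure (code_bits m) {c. c ! k = b} = 1 / 2"
    unfolding code_bits_eq measure_pmf_of_set[OF codewords_nonempty finite_codewords] Int
    using card B(3) by simp
  show "pmf (cond_pmf (code_bits m) {c. c ! k = b}) c = pmf (pmf_of_set ?B) c"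
    unfolding pmf_cond[OF ne] half pmf_of_set[OF B(1,2)]
    using card by (simp add: code_bits_eq indicator_def)
qed

section \<open>The capacity as a fading average of bit informations\<close>

lemma expectation_code_bits:
  "measure_pmf.expectation (code_bits m) f = (\<Sum>c\<in>codewords m. f c) / card (codewords m)" for f :: "_ \<Rightarrow> real"
  by (simp add: code_bits_eq integral_pmf_of_set)

text \<open>The factor \<open>noise_density N0 y\<close> also appears in the density given a bit. It
  cancels in the quotient inside the capacity and leaves exactly
  \<open>bit_log_ratio\<close>.\<close>

lemma density_given_fading_eq:
  assumes "0 < N0"
  shows "density_given_fading m X L N0 h y =
    noise_density N0 y * mean_lik N0 (codewords m) (\<lambda>c. h * tx_symbol X L c) y"
  using assms
  by (simp add: density_given_fading_def output_density_def expectation_code_bits noise_density_diff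
      mean_lik_def sum_distrib_left)

lemma density_given_bit_fading_eq:
  assumes "0 < N0" "k < m"
  shows "density_given_bit_fading m X L N0 k b h y =
    noise_density N0 y * mean_lik N0 {c \<in> codewords m. c ! k = b} (\<lambda>c. h * tx_symbol X L c) y"
proof -
  have B: "{c \<in> codewords m. c ! k = b} \<noteq> {}" "finite {c \<in> codewords m. c ! k = b}"
    by (rule bit_class_nonempty[OF assms(2)], rule finite_bit_class)
  show ?thesis
    using assms(1)
    by (simp add: density_given_bit_fading_def output_density_def cond_code_bits_eq[OF assms(2)]
        integral_pmf_of_set[OF B] noise_density_diff mean_lik_def sum_distrib_left)
qed

text \<open>Fubini for integrands that need not be bounded. The bound \<open>B\<close> on the
  absolute integral over the noise is uniform in \<open>h\<close>, and \<open>\<nu>\<close> is a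
  probability measure, so joint integrability follows.\<close>

lemma integral_channel_space:
  fixes \<nu> :: "(real ^ 'n) measure" and f :: "bool list \<Rightarrow> real ^ 'n \<Rightarrow> real ^ 'n \<Rightarrow> real"
  assumes "prob_space \<nu>" and sets: "sets \<nu> = sets borel" and N0: "0 < N0"
    and meas: "\<And>c. (\<lambda>(h, z). f c h z) \<in> borel_measurable (\<nu> \<Otimes>\<^sub>M noise N0)"
    and int: "\<And>c h. c \<in> codewords m \<Longrightarrow> integrable (noise N0) (f c h)"
    and bound: "\<And>c h. c \<in> codewords m \<Longrightarrow> (LINT z|noise N0. \<bar>f c h z\<bar>) \<le> B"
  defines "g \<equiv> \<lambda>h. (\<Sum>c\<in>codewords m. LINT z|noise N0. f c h z) / card (codewords m)"
  shows "integrable \<nu> g"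
    and "(LINT (c, h, z)|channel_space (code_bits m) \<nu> N0. f c h z) = (LINT h|\<nu>. g h)"
proof -
  interpret \<nu>: prob_space \<nu> by fact
  interpret nz: prob_space "noise N0 :: (real ^ 'n) measure" by (rule prob_space_noise[OF N0])
  interpret P: pair_prob_space \<nu> "noise N0 :: (real ^ 'n) measure" ..
  interpret Q: pair_prob_space "measure_pmf (code_bits m)" "\<nu> \<Otimes>\<^sub>M (noise N0 :: (real ^ 'n) measure)" ..
  have intP: "integrable (\<nu> \<Otimes>\<^sub>M noise N0) (\<lambda>(h, z). f c h z)" if c: "c \<in> codewords m" for c
  proof (rule P.Fubini_integrable[OF meas])
    have "(\<lambda>h. LINT z|noise N0. norm (case (h, z) of (h, z) \<Rightarrow> f c h z)) \<in> borel_measurable \<nu>"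
      using meas[of c] by (intro nz.borel_measurable_lebesgue_integral) (simp add: split_beta')
    then show "integrable \<nu> (\<lambda>h. LINT z|noise N0. norm (case (h, z) of (h, z) \<Rightarrow> f c h z))"
      by (rule \<nu>.integrable_const_bound[of _ B, rotated]) (use bound[OF c] in auto)
  qed (use int[OF c] in auto)
  have intg: "integrable \<nu> (\<lambda>h. LINT z|noise N0. f c h z)" if "c \<in> codewords m" for c
    using P.integrable_fst'[OF intP[OF that]] by simp
  then show "integrable \<nu> g" unfolding g_def by auto
  have "(\<lambda>(c, h, z). f c h z) \<in> borel_measurable (count_space UNIV \<Otimes>\<^sub>M (\<nu> \<Otimes>\<^sub>M noise N0))"
    by (rule measurable_pair_measure_countable1) (use meas in auto)
  moreover have "sets (measure_pmf (code_bits m) \<Otimes>\<^sub>M (\<nu> \<Otimes>\<^sub>M (noise N0 :: (real ^ 'n) measure))) =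
      sets (count_space UNIV \<Otimes>\<^sub>M (\<nu> \<Otimes>\<^sub>M (noise N0 :: (real ^ 'n) measure)))"
    by (rule sets_pair_measure_cong) simp_all
  ultimately have measQ: "(\<lambda>(c, h, z). f c h z) \<in>
      borel_measurable (measure_pmf (code_bits m) \<Otimes>\<^sub>M (\<nu> \<Otimes>\<^sub>M noise N0))"
    using measurable_cong_sets[OF _ refl] by blast
  have set: "set_pmf (code_bits m) = codewords m"
    unfolding code_bits_eq by (rule set_pmf_of_set) auto
  have "integrable (measure_pmf (code_bits m) \<Otimes>\<^sub>M (\<nu> \<Otimes>\<^sub>M noise N0)) (\<lambda>(c, h, z). f c h z)"
  proof (rule Q.Fubini_integrable[OF measQ])
    show "AE c in measure_pmf (code_bits m). integrable (\<nu> \<Otimes>\<^sub>M noise N0) (\<lambda>q. case (c, q) of (c, h, z) \<Rightarrow> f c h z)"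
      using intP by (auto simp: AE_measure_pmf_iff set)
  qed (auto intro!: integrable_measure_pmf_finite simp: set)
  then have "(LINT (c, h, z)|channel_space (code_bits m) \<nu> N0. f c h z) =
      measure_pmf.expectation (code_bits m) (\<lambda>c. LINT (h, z)|(\<nu> \<Otimes>\<^sub>M noise N0). f c h z)"
    unfolding channel_space_def by (subst Q.integral_fst'[symmetric]) auto
  also have "\<dots> = (\<Sum>c\<in>codewords m. LINT (h, z)|(\<nu> \<Otimes>\<^sub>M noise N0). f c h z) / card (codewords m)"
    by (rule expectation_code_bits)
  also have "(\<Sum>c\<in>codewords m. LINT (h, z)|(\<nu> \<Otimes>\<^sub>M noise N0). f c h z) =
      (\<Sum>c\<in>codewords m. LINT h|\<nu>. LINT z|noise N0. f c h z)"
    by (rule sum.cong[OF refl]) (subst P.integral_fst'[symmetric], use intP in auto)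
  also have "\<dots> / card (codewords m) = (LINT h|\<nu>. g h)"
    unfolding g_def using intg by simp
  finally show "(LINT (c, h, z)|channel_space (code_bits m) \<nu> N0. f c h z) = (LINT h|\<nu>. g h)" .
qed

text \<open>The mutual information, in nats, of bit \<open>k\<close> and the output for a fixed
  fading value \<open>h\<close>.\<close>

definition bit_info :: "real \<Rightarrow> nat \<Rightarrow> nat \<Rightarrow> (bool list \<Rightarrow> real ^ 'n) \<Rightarrow> real ^ 'n \<Rightarrow> real" where
  "bit_info N0 m k x h =
     (\<Sum>c\<in>codewords m. LINT z|noise N0.
        bit_log_ratio N0 (codewords m) (\<lambda>c. c ! k) (\<lambda>c. h * x c) c z) / card (codewords m)"

lemma measurable_bit_log_ratio:
  fixes \<nu> :: "(real ^ 'n) measure"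
  assumes [measurable_cong]: "sets \<nu> = sets borel"
  shows "(\<lambda>(h, z). bit_log_ratio N0 I \<beta> (\<lambda>c. h * x c) c z) \<in> borel_measurable (\<nu> \<Otimes>\<^sub>M noise N0)"
proof -
  have [measurable]: "(\<lambda>h. h * x c) \<in> borel_measurable borel" for c
    by (rule measurable_vec_mult)
  show ?thesis
    unfolding bit_log_ratio_def mean_lik_def lik_def by measurable
qed

lemma
  fixes \<nu> :: "(real ^ 'n) measure"
  assumes \<nu>: "prob_space \<nu>" and sets: "sets \<nu> = sets borel" and N0: "0 < N0"
  shows integrable_bit_info: "k < m \<Longrightarrow> integrable \<nu> (bit_info N0 m k x)"
    and bicm_capacity_eq: "bicm_capacity m X L \<nu> N0 =
      (\<Sum>k<m. LINT h|\<nu>. bit_info N0 m k (tx_symbol X L) h) / ln 2"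
proof -
  let ?f = "\<lambda>k x c h. bit_log_ratio N0 (codewords m) (\<lambda>c. c ! k) (\<lambda>c. h * x c) c"
  note bit = finite_codewords codewords_nonempty card_codewords_bit
  have int: "integrable (noise N0) (?f k x c h)"
    if "k < m" "c \<in> codewords m" for k c h and x :: "bool list \<Rightarrow> real ^ 'n"
    by (rule integrable_bit_log_ratio[OF N0 bit, OF that])
  have bound: "(LINT z|noise N0. \<bar>?f k x c h z\<bar>) \<le> 2 * ln 2 * card (codewords m)"
    if "k < m" "c \<in> codewords m" for k c h and x :: "bool list \<Rightarrow> real ^ 'n"
    by (rule integral_abs_bit_log_ratio_le[OF N0 bit, OF that])
  have bit_info: "bit_info N0 m k x = (\<lambda>h. (\<Sum>c\<in>codewords m. LINT z|noise N0. ?f k x c h z) / card (codewords m))"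
    for k and x :: "bool list \<Rightarrow> real ^ 'n"
    by (simp add: bit_info_def fun_eq_iff)
  show "integrable \<nu> (bit_info N0 m k x)" if "k < m"
    unfolding bit_info
    by (rule integral_channel_space(1)[OF \<nu> sets N0 measurable_bit_log_ratio[OF sets] int[OF that] bound[OF that]])
  have "(LINT (c, h, z)|channel_space (code_bits m) \<nu> N0.
      (let y = received X L c h z in
         log 2 (density_given_bit_fading m X L N0 k (c ! k) h y / density_given_fading m X L N0 h y))) =
      (LINT h|\<nu>. bit_info N0 m k (tx_symbol X L) h) / ln 2" if k: "k < m" for k
  proof -
    have "(let y = received X L c h z in
         log 2 (density_given_bit_fading m X L N0 k (c ! k) h y / density_given_fading m X L N0 h y)) =
        ?f k (tx_symbol X L) c h z / ln 2" for c h z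
      using noise_density_pos[OF N0]
      by (simp add: Let_def log_def density_given_fading_eq[OF N0] density_given_bit_fading_eq[OF N0 k]
          received_def bit_log_ratio_def less_imp_neq[OF noise_density_pos[OF N0], symmetric])
    then have "(LINT (c, h, z)|channel_space (code_bits m) \<nu> N0.
      (let y = received X L c h z in
         log 2 (density_given_bit_fading m X L N0 k (c ! k) h y / density_given_fading m X L N0 h y))) =
      (LINT (c, h, z)|channel_space (code_bits m) \<nu> N0. ?f k (tx_symbol X L) c h z / ln 2)"
      by simp
    also have "\<dots> = (LINT q|channel_space (code_bits m) \<nu> N0. (case q of (c, h, z) \<Rightarrow> ?f k (tx_symbol X L) c h z) / ln 2)"
      by (simp add: split_beta')
    also have "\<dots> = (LINT (c, h, z)|channel_space (code_bits m) \<nu> N0. ?f k (tx_symbol X L) c h z) / ln 2"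
      by simp
    also have "(LINT (c, h, z)|channel_space (code_bits m) \<nu> N0. ?f k (tx_symbol X L) c h z) =
        (LINT h|\<nu>. bit_info N0 m k (tx_symbol X L) h)"
      unfolding bit_info
      by (rule integral_channel_space(2)[OF \<nu> sets N0 measurable_bit_log_ratio[OF sets] int[OF k] bound[OF k]])
    finally show ?thesis .
  qed
  then show "bicm_capacity m X L \<nu> N0 =
      (\<Sum>k<m. LINT h|\<nu>. bit_info N0 m k (tx_symbol X L) h) / ln 2"
    unfolding bicm_capacity_def sum_divide_distrib by (intro sum.cong) auto
qed

lemma norm_vec_mult_le: "norm (h * x) \<le> norm h * norm x" for h x :: "real ^ 'n"
proof -
  have "(norm (h * x))\<^sup>2 = (\<Sum>i\<in>UNIV. (h $ i)\<^sup>2 * (x $ i)\<^sup>2)"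
    unfolding power2_norm_eq_inner inner_vec_def by (simp add: power2_eq_square mult_ac)
  also have "\<dots> \<le> (\<Sum>i\<in>UNIV. (h $ i)\<^sup>2 * (norm x)\<^sup>2)"
  proof (intro sum_mono mult_left_mono)
    fix i show "(x $ i)\<^sup>2 \<le> (norm x)\<^sup>2"
      using component_le_norm_cart[of x i] by (metis abs_ge_zero power2_abs power_mono)
  qed simp
  also have "\<dots> = (norm h * norm x)\<^sup>2"
    unfolding power_mult_distrib power2_norm_eq_inner[of h] inner_vec_def
    by (simp add: sum_distrib_right power2_eq_square)
  finally show ?thesis by (rule power2_le_imp_le) simp
qed

text \<open>Half the difference of the mean symbols of the two classes of bit \<open>k\<close>;
  equivalently, the Fourier coefficient of \<open>x\<close> at the sign of that bit.\<close>

definition bit_contrast :: "nat \<Rightarrow> nat \<Rightarrow> (bool list \<Rightarrow> real ^ 'n) \<Rightarrow> real ^ 'n" where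
  "bit_contrast m k x = (\<Sum>c\<in>codewords m. (if c ! k then 1 else -1) *\<^sub>R x c) /\<^sub>R 2 ^ m"

text \<open>The uniform estimate with \<open>s = 2 * (norm h * R)^2 / N0\<close>, whence
  \<open>240 = 60 * 2^2\<close>. The class means differ by twice the contrast times
  \<open>h\<close>, which removes the 4 from the denominator \<open>4 * N0\<close>.\<close>

lemma bit_info_approx:
  fixes x :: "bool list \<Rightarrow> real ^ 'n"
  assumes N0: "0 < N0" and k: "k < m" and R: "\<And>c. c \<in> codewords m \<Longrightarrow> norm (x c) \<le> R"
  shows "\<bar>bit_info N0 m k x h - (norm (h * bit_contrast m k x))\<^sup>2 / N0\<bar> \<le> 240 * R ^ 4 * norm h ^ 4 / N0\<^sup>2"
proof -
  let ?A = "\<lambda>P. (\<Sum>c\<in>{c \<in> codewords m. P c}. h * x c) /\<^sub>R card {c \<in> codewords m. P c}"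
  have s: "2 * (norm (h * x c))\<^sup>2 / N0 \<le> 2 * (norm h * R)\<^sup>2 / N0" if "c \<in> codewords m" for c
    using N0 norm_vec_mult_le[of h "x c"] R[OF that]
    by (intro divide_right_mono mult_left_mono power_mono order_trans[OF norm_vec_mult_le] mult_left_mono) auto
  have card: "real (card {c \<in> codewords m. c ! k = b}) = 2 ^ m / 2" for b
    using arg_cong[OF card_codewords_bit[OF k, of b], of real] card_codewords[of m] by simp
  have "?A (\<lambda>c. c ! k) - ?A (\<lambda>c. \<not> c ! k) = 2 *\<^sub>R (h * bit_contrast m k x)"
  proof -
    have "codewords m = {c \<in> codewords m. c ! k} \<union> {c \<in> codewords m. \<not> c ! k}" by auto
    then have "(\<Sum>c\<in>codewords m. (if c ! k then 1 else -1) *\<^sub>R x c) =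
        (\<Sum>c\<in>{c \<in> codewords m. c ! k} \<union> {c \<in> codewords m. \<not> c ! k}. (if c ! k then 1 else -1) *\<^sub>R x c)"
      by (rule arg_cong)
    also have "\<dots> = (\<Sum>c\<in>{c \<in> codewords m. c ! k}. (if c ! k then 1 else -1) *\<^sub>R x c)
        + (\<Sum>c\<in>{c \<in> codewords m. \<not> c ! k}. (if c ! k then 1 else -1) *\<^sub>R x c)"
      by (rule sum.union_disjoint) (auto intro: finite_bit_class)
    also have "\<dots> = (\<Sum>c\<in>{c \<in> codewords m. c ! k}. x c) - (\<Sum>c\<in>{c \<in> codewords m. \<not> c ! k}. x c)"
      by (simp add: sum_negf)
    finally have T: "(\<Sum>c\<in>codewords m. (if c ! k then 1 else -1) *\<^sub>R x c) = \<dots>" .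
    have "?A (\<lambda>c. c ! k) - ?A (\<lambda>c. \<not> c ! k) = (2 / 2 ^ m) *\<^sub>R
        (h * ((\<Sum>c\<in>{c \<in> codewords m. c ! k}. x c) - (\<Sum>c\<in>{c \<in> codewords m. \<not> c ! k}. x c)))"
      using card[of True] card[of False]
      by (simp only: simp_thms sum_distrib_left[symmetric] right_diff_distrib scaleR_diff_right
          inverse_eq_divide divide_divide_eq_right mult_1)
    also have "\<dots> = 2 *\<^sub>R (h * bit_contrast m k x)"
      unfolding bit_contrast_def T by (simp add: vec_eq_iff divide_inverse)
    finally show ?thesis .
  qed
  then have q: "(norm (?A (\<lambda>c. c ! k) - ?A (\<lambda>c. \<not> c ! k)))\<^sup>2 / (4 * N0) = (norm (h * bit_contrast m k x))\<^sup>2 / N0"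
    by (simp add: power_mult_distrib)
  have "\<bar>bit_info N0 m k x h - (norm (?A (\<lambda>c. c ! k) - ?A (\<lambda>c. \<not> c ! k)))\<^sup>2 / (4 * N0)\<bar>
      \<le> 60 * (2 * (norm h * R)\<^sup>2 / N0)\<^sup>2"
    unfolding bit_info_def
    by (rule mean_integral_bit_log_ratio_approx[OF N0 finite_codewords codewords_nonempty
          card_codewords_bit[OF k] s])
  also have "60 * (2 * (norm h * R)\<^sup>2 / N0)\<^sup>2 = 240 * R ^ 4 * norm h ^ 4 / N0\<^sup>2"
    by (simp add: power_divide power_mult_distrib flip: power_mult)
  finally show ?thesis unfolding q .
qed

section \<open>Moments of the fading and the first-order coefficient\<close>

lemma le_suminf_indicator_less:
  fixes x :: real
  shows "ennreal x \<le> (\<Sum>n. indicator {n. real n < x} n)"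
proof -
  have "ennreal x \<le> ennreal (real (nat \<lceil>x\<rceil>))"
    by (rule ennreal_leI) (rule real_nat_ceiling_ge)
  also have "\<dots> = (\<Sum>n<nat \<lceil>x\<rceil>. indicator {n. real n < x} n)"
  proof -
    have "real n < x" if "n < nat \<lceil>x\<rceil>" for n
      using that by linarith
    then have "(\<Sum>n<nat \<lceil>x\<rceil>. indicator {n. real n < x} n :: ennreal) = (\<Sum>n<nat \<lceil>x\<rceil>. 1)"
      by (intro sum.cong) auto
    then show ?thesis by (simp add: ennreal_of_nat_eq_real_of_nat)
  qed
  also have "\<dots> \<le> (\<Sum>n. indicator {n. real n < x} n)"
    by (rule sum_le_suminf) auto
  finally show ?thesis .
qed

text \<open>A nonnegative number is at most the count of naturals below it, so the fourth moment is
  at most the sum over \<open>n\<close> of the probabilities of \<open>norm h ^ 4 > n\<close>, that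
  is, of \<open>(norm h)^2 > sqrt n\<close>. The tail condition at \<open>sqrt n\<close> bounds
  these by \<open>exp (- (sqrt n powr \<omega>))\<close>, which decays faster than
  \<open>1 / n^2\<close> for every positive \<open>\<omega>\<close>.\<close>

lemma fading_law_integrable_norm_power4:
  fixes \<nu> :: "(real ^ 'n) measure"
  assumes "fading_law \<nu> \<kappa>"
  shows "integrable \<nu> (\<lambda>h. norm h ^ 4)"
proof (rule integrableI_nonneg)
  have \<nu>: "prob_space \<nu>" and sets [measurable_cong]: "sets \<nu> = sets borel"
    using assms by (auto simp: fading_law_def)
  interpret prob_space \<nu> by fact
  obtain \<omega> where \<omega>: "0 < \<omega>" and
    tail: "\<forall>\<^sub>F \<Delta> in at_top. measure \<nu> {h. (norm h)\<^sup>2 > \<Delta>} \<le> exp (- (\<Delta> powr \<omega>))"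
    using assms by (auto simp: fading_law_def)
  have space: "space \<nu> = UNIV" using sets_eq_imp_space_eq[OF sets] by simp
  show "(\<lambda>h. norm h ^ 4) \<in> borel_measurable \<nu>" by measurable
  let ?p = "\<lambda>n. measure \<nu> {h. (norm h)\<^sup>2 > sqrt (real n)}"
  have "summable ?p"
  proof (rule summable_comparison_test_ev)
    have "filterlim (\<lambda>n. sqrt (real n)) at_top sequentially" by real_asymp
    from eventually_compose_filterlim[OF tail this]
    show "\<forall>\<^sub>F n in sequentially. norm (?p n) \<le> exp (- (sqrt (real n) powr \<omega>))" by simp
    have "(\<lambda>n. exp (- (sqrt (real n) powr \<omega>))) \<in> O(\<lambda>n. inverse (real n ^ 2))"
      using \<omega> by real_asymp
    moreover have "summable (\<lambda>n. norm (inverse (real n ^ 2)))"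
      using inverse_power_summable[of 2, where 'a = real] by simp
    ultimately show "summable (\<lambda>n. exp (- (sqrt (real n) powr \<omega>)))"
      by (rule summable_comparison_test_bigo[rotated])
  qed
  have less_iff: "real n < norm h ^ 4 \<longleftrightarrow> sqrt (real n) < (norm h)\<^sup>2" for n and h :: "real ^ 'n"
  proof -
    have "sqrt (norm h ^ 4) = (norm h)\<^sup>2" by (rule real_sqrt_unique) (simp_all flip: power_mult)
    then show ?thesis by (metis real_sqrt_less_iff)
  qed
  have "(\<integral>\<^sup>+ h. ennreal (norm h ^ 4) \<partial>\<nu>) \<le>
      (\<integral>\<^sup>+ h. (\<Sum>n. indicator {n. real n < norm h ^ 4} n) \<partial>\<nu>)"
    by (intro nn_integral_mono le_suminf_indicator_less)
  also have "\<dots> = (\<integral>\<^sup>+ h. (\<Sum>n. indicator {h. (norm h)\<^sup>2 > sqrt (real n)} h) \<partial>\<nu>)"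
    by (intro nn_integral_cong suminf_cong) (auto simp: indicator_def less_iff)
  also have "\<dots> = (\<Sum>n. \<integral>\<^sup>+ h. indicator {h. (norm h)\<^sup>2 > sqrt (real n)} h \<partial>\<nu>)"
    by (rule nn_integral_suminf) measurable
  also have "\<dots> = (\<Sum>n. ennreal (?p n))"
    by (simp add: sets emeasure_eq_measure)
  also have "\<dots> < \<infinity>"
    using \<open>summable ?p\<close> by (simp add: suminf_ennreal2)
  finally show "(\<integral>\<^sup>+ h. ennreal (norm h ^ 4) \<partial>\<nu>) < \<infinity>" .
qed simp

text \<open>The squared norm is a sum over components, so only the marginals enter, and all of them
  equal \<open>\<kappa>\<close>.\<close>

lemma
  fixes \<nu> :: "(real ^ 'n) measure"
  assumes "fading_law \<nu> \<kappa>"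
  shows fading_law_integrable_mult: "integrable \<nu> (\<lambda>h. (norm (h * d))\<^sup>2)"
    and fading_law_integral_mult: "(LINT h|\<nu>. (norm (h * d))\<^sup>2) = (LINT t|\<kappa>. t\<^sup>2) * (norm d)\<^sup>2"
proof -
  have sets [measurable_cong]: "sets \<nu> = sets borel" and
    \<kappa>: "\<And>i. distr \<nu> borel (\<lambda>h. h $ i) = \<kappa>" and int: "integrable \<kappa> (\<lambda>t. t\<^sup>2)"
    using assms by (auto simp: fading_law_def)
  have eq: "(norm (h * d))\<^sup>2 = (\<Sum>i\<in>UNIV. (h $ i)\<^sup>2 * (d $ i)\<^sup>2)" for h
    unfolding power2_norm_eq_inner inner_vec_def by (simp add: power2_eq_square mult_ac)
  have "has_bochner_integral \<nu> (\<lambda>h. (h $ i)\<^sup>2) (LINT t|\<kappa>. t\<^sup>2)" for i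
  proof -
    have "has_bochner_integral (distr \<nu> borel (\<lambda>h. h $ i)) (\<lambda>t. t\<^sup>2) (LINT t|\<kappa>. t\<^sup>2)"
      using int by (simp add: \<kappa> has_bochner_integral_integrable)
    moreover have "(\<lambda>h. h $ i) \<in> measurable \<nu> borel" by measurable
    ultimately show ?thesis by (simp add: has_bochner_integral_iff integrable_distr_eq integral_distr)
  qed
  then have "has_bochner_integral \<nu> (\<lambda>h. \<Sum>i\<in>UNIV. (h $ i)\<^sup>2 * (d $ i)\<^sup>2) (\<Sum>i\<in>UNIV. (LINT t|\<kappa>. t\<^sup>2) * (d $ i)\<^sup>2)"
    by (intro has_bochner_integral_sum has_bochner_integral_mult_left) auto
  moreover have "(\<Sum>i\<in>UNIV. (LINT t|\<kappa>. t\<^sup>2) * (d $ i)\<^sup>2) = (LINT t|\<kappa>. t\<^sup>2) * (norm d)\<^sup>2"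
    unfolding power2_norm_eq_inner inner_vec_def by (simp add: sum_distrib_left power2_eq_square)
  ultimately show "integrable \<nu> (\<lambda>h. (norm (h * d))\<^sup>2)"
    "(LINT h|\<nu>. (norm (h * d))\<^sup>2) = (LINT t|\<kappa>. t\<^sup>2) * (norm d)\<^sup>2"
    unfolding eq by (auto simp: has_bochner_integral_iff)
qed

lemma bicm_capacity_expansion:
  fixes X :: "(real ^ 'n) list" and L :: "bool list list"
  assumes "fading_law \<nu> \<kappa>"
  shows "\<exists>C. \<forall>N0>0. \<bar>bicm_capacity m X L \<nu> N0
      - (LINT t|\<kappa>. t\<^sup>2) * (\<Sum>k<m. (norm (bit_contrast m k (tx_symbol X L)))\<^sup>2) / ln 2 / N0\<bar> \<le> C / N0\<^sup>2"
proof -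
  have \<nu>: "prob_space \<nu>" and sets: "sets \<nu> = sets borel"
    using assms by (auto simp: fading_law_def)
  let ?x = "tx_symbol X L"
  let ?d = "\<lambda>k. bit_contrast m k ?x"
  let ?E = "LINT t|\<kappa>. t\<^sup>2"
  define R where "R = (\<Sum>c\<in>codewords m. norm (?x c))"
  define K where "K = 240 * R ^ 4 * (LINT h|\<nu>. norm h ^ 4)"
  have R: "norm (?x c) \<le> R" if "c \<in> codewords m" for c
    unfolding R_def by (rule member_le_sum[OF that]) auto
  have bit: "\<bar>(LINT h|\<nu>. bit_info N0 m k ?x h) - ?E * (norm (?d k))\<^sup>2 / N0\<bar> \<le> K / N0\<^sup>2"
    if N0: "0 < N0" and k: "k < m" for N0 k
  proof -
    note int = integrable_bit_info[OF \<nu> sets N0 k, of ?x] fading_law_integrable_mult[OF assms, of "?d k"]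
      fading_law_integrable_norm_power4[OF assms]
    have "(LINT h|\<nu>. bit_info N0 m k ?x h) - ?E * (norm (?d k))\<^sup>2 / N0 =
        (LINT h|\<nu>. bit_info N0 m k ?x h - (norm (h * ?d k))\<^sup>2 / N0)"
      using int by (simp add: fading_law_integral_mult[OF assms])
    also have "\<bar>\<dots>\<bar> \<le> (LINT h|\<nu>. \<bar>bit_info N0 m k ?x h - (norm (h * ?d k))\<^sup>2 / N0\<bar>)"
      by (rule integral_abs_bound)
    also have "\<dots> \<le> (LINT h|\<nu>. 240 * R ^ 4 * norm h ^ 4 / N0\<^sup>2)"
      using int bit_info_approx[OF N0 k R] by (intro integral_mono) auto
    also have "\<dots> = K / N0\<^sup>2"
      by (simp add: K_def)
    finally show ?thesis .
  qed
  have "\<bar>bicm_capacity m X L \<nu> N0 - ?E * (\<Sum>k<m. (norm (?d k))\<^sup>2) / ln 2 / N0\<bar> \<le> (m * K / ln 2) / N0\<^sup>2"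
    if N0: "0 < N0" for N0
  proof -
    have "bicm_capacity m X L \<nu> N0 - ?E * (\<Sum>k<m. (norm (?d k))\<^sup>2) / ln 2 / N0 =
        (\<Sum>k<m. (LINT h|\<nu>. bit_info N0 m k ?x h) - ?E * (norm (?d k))\<^sup>2 / N0) / ln 2"
      unfolding bicm_capacity_eq[OF \<nu> sets N0] sum_subtractf
      by (simp add: diff_divide_distrib sum_distrib_left sum_divide_distrib mult.commute)
    also have "\<bar>\<dots>\<bar> = \<bar>\<Sum>k<m. (LINT h|\<nu>. bit_info N0 m k ?x h) - ?E * (norm (?d k))\<^sup>2 / N0\<bar> / ln 2"
      by simp
    also have "\<dots> \<le> (\<Sum>k<m. K / N0\<^sup>2) / ln 2"
      by (intro divide_right_mono order_trans[OF sum_abs sum_mono]) (use bit[OF N0] in auto)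
    finally show ?thesis by (simp add: mult.commute)
  qed
  then show ?thesis by blast
qed

lemma inverse_square_bound_imp_zero:
  fixes D c :: real
  assumes "\<forall>\<^sub>F t in at_top. \<bar>D / t\<bar> \<le> c / t\<^sup>2"
  shows "D = 0"
proof (rule ccontr)
  assume D: "D \<noteq> 0"
  have "\<forall>\<^sub>F t in at_top. \<bar>D / t\<bar> \<le> c / t\<^sup>2 \<and> t > 0 \<and> t > c / \<bar>D\<bar>"
    by (intro eventually_conj assms eventually_gt_at_top)
  then obtain t where t: "\<bar>D / t\<bar> \<le> c / t\<^sup>2" "t > 0" "t > c / \<bar>D\<bar>"
    by (auto dest: eventually_happens simp: trivial_limit_at_top_linorder)
  then show False using D by (simp add: field_simps power2_eq_square abs_mult)
qed

text \<open>Positive energy gives \<open>S > 0\<close>, so an error of order SNR squared is the same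
  as one of order \<open>1 / N0^2\<close>. Both the expansion, with coefficient \<open>A\<close>,
  and the definition, with coefficient \<open>B\<close>, are then statements in powers of
  \<open>1 / N0\<close>, and \<open>A = B\<close> is forced. The factor \<open>log 2 (exp 1)\<close>
  is \<open>1 / ln 2\<close> and drops out.\<close>

lemma bicm_foo_iff_energy:
  fixes X :: "(real ^ 'n) list"
  assumes fading: "fading_law \<nu> \<kappa>" and pos: "0 < symbol_energy m X L"
  shows "bicm_foo m X L \<nu> \<kappa> \<longleftrightarrow>
    (\<Sum>k<m. (norm (bit_contrast m k (tx_symbol X L)))\<^sup>2) = symbol_energy m X L"
proof -
  let ?E = "LINT t|\<kappa>. t\<^sup>2"
  let ?G = "\<Sum>k<m. (norm (bit_contrast m k (tx_symbol X L)))\<^sup>2"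
  have E: "0 < ?E" using fading by (simp add: fading_law_def)
  define S where "S = ?E * symbol_energy m X L"
  define A where "A = ?E * ?G / ln 2"
  define B where "B = S / ln 2"
  let ?I = "bicm_capacity m X L \<nu>"
  have S: "0 < S" using E pos by (simp add: S_def)
  obtain C where C: "\<And>N0. 0 < N0 \<Longrightarrow> \<bar>?I N0 - A / N0\<bar> \<le> C / N0\<^sup>2"
    using bicm_capacity_expansion[OF fading, of m X L] unfolding A_def by blast
  have foo: "bicm_foo m X L \<nu> \<kappa> \<longleftrightarrow> (\<lambda>N0. ?I N0 - B / N0) \<in> O[at_top](\<lambda>N0. (S / N0)\<^sup>2)"
    by (simp add: bicm_foo_def is_bicm_coeff_def snr_def S_def B_def log_def)
  have "bicm_foo m X L \<nu> \<kappa> \<longleftrightarrow> A = B"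
  proof
    assume "bicm_foo m X L \<nu> \<kappa>"
    then obtain c where c: "\<forall>\<^sub>F N0 in at_top. norm (?I N0 - B / N0) \<le> c * norm ((S / N0)\<^sup>2)"
      unfolding foo by (auto elim!: landau_o.bigE)
    have "\<forall>\<^sub>F N0 in at_top. \<bar>(A - B) / N0\<bar> \<le> (C + c * S\<^sup>2) / N0\<^sup>2"
      using c eventually_gt_at_top[of 0]
    proof eventually_elim
      case (elim N0)
      have "(A - B) / N0 = (?I N0 - B / N0) - (?I N0 - A / N0)"
        by (simp add: diff_divide_distrib)
      also have "\<bar>\<dots>\<bar> \<le> \<bar>?I N0 - B / N0\<bar> + \<bar>?I N0 - A / N0\<bar>"
        by (rule abs_triangle_ineq4)
      also have "\<dots> \<le> c * (S / N0)\<^sup>2 + C / N0\<^sup>2"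
        using elim C by (intro add_mono) auto
      finally show ?case by (simp add: power_divide add_divide_distrib add.commute)
    qed
    then have "A - B = 0" by (rule inverse_square_bound_imp_zero)
    then show "A = B" by simp
  next
    assume "A = B"
    have "(\<lambda>N0. ?I N0 - B / N0) \<in> O[at_top](\<lambda>N0. (S / N0)\<^sup>2)"
    proof (rule bigoI[of _ "C / S\<^sup>2"])
      show "\<forall>\<^sub>F N0 in at_top. norm (?I N0 - B / N0) \<le> C / S\<^sup>2 * norm ((S / N0)\<^sup>2)"
        using eventually_gt_at_top[of 0]
      proof eventually_elim
        case (elim N0)
        then show ?case using C[OF elim] S \<open>A = B\<close> by (simp add: power_divide)
      qed
    qed
    then show "bicm_foo m X L \<nu> \<kappa>" unfolding foo .
  qed
  also have "\<dots> \<longleftrightarrow> ?G = symbol_energy m X L"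
    using E by (simp add: A_def B_def S_def)
  finally show ?thesis .
qed

section \<open>Orthogonality of the bit signs and equality in Bessel's inequality\<close>

definition bpsk :: "bool \<Rightarrow> real" where
  "bpsk b = (if b then 1 else -1)"

text \<open>For \<open>j \<noteq> k\<close>, flipping bit \<open>k\<close> permutes the codewords
  and negates every summand.\<close>

lemma bpsk_orthogonal:
  assumes "j < m" "k < m"
  shows "(\<Sum>c\<in>codewords m. bpsk (c ! j) * bpsk (c ! k)) = (if j = k then 2 ^ m else 0)"
proof (cases "j = k")
  case True
  have "bpsk b * bpsk b = 1" for b by (simp add: bpsk_def)
  with True show ?thesis by (simp add: card_codewords)
next
  case False
  let ?f = "\<lambda>c :: bool list. c[k := \<not> c ! k]"
  let ?s = "\<Sum>c\<in>codewords m. bpsk (c ! j) * bpsk (c ! k)"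
  have inv: "?f (?f c) = c" if "c \<in> codewords m" for c using that assms by (simp add: in_codewords)
  have "?s = (\<Sum>c\<in>codewords m. bpsk (?f c ! j) * bpsk (?f c ! k))"
    by (rule sum.reindex_bij_witness[of _ ?f ?f]) (use inv in \<open>auto simp: in_codewords\<close>)
  also have "\<dots> = (\<Sum>c\<in>codewords m. - (bpsk (c ! j) * bpsk (c ! k)))"
    using assms False by (intro sum.cong) (auto simp: bpsk_def in_codewords)
  finally show ?thesis using False by (simp add: sum_negf)
qed

lemma bpsk_combination_energy:
  fixes v :: "nat \<Rightarrow> 'v :: real_inner"
  shows "(\<Sum>c\<in>codewords m. (norm (\<Sum>k<m. bpsk (c ! k) *\<^sub>R v k))\<^sup>2) = 2 ^ m * (\<Sum>k<m. (norm (v k))\<^sup>2)"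
proof -
  have "(\<Sum>c\<in>codewords m. (norm (\<Sum>k<m. bpsk (c ! k) *\<^sub>R v k))\<^sup>2) =
      (\<Sum>c\<in>codewords m. \<Sum>j<m. \<Sum>k<m. bpsk (c ! j) * bpsk (c ! k) * (v j \<bullet> v k))"
    by (simp add: power2_norm_eq_inner inner_sum_left inner_sum_right sum_distrib_left mult.assoc mult.left_commute inner_commute)
  also have "\<dots> = (\<Sum>j<m. \<Sum>k<m. (\<Sum>c\<in>codewords m. bpsk (c ! j) * bpsk (c ! k)) * (v j \<bullet> v k))"
    by (subst sum.swap, rule sum.cong[OF refl], subst sum.swap) (simp add: sum_distrib_right)
  also have "\<dots> = (\<Sum>j<m. \<Sum>k<m. (if j = k then 2 ^ m else 0) * (v j \<bullet> v k))"
    by (intro sum.cong refl) (simp add: bpsk_orthogonal)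
  also have "\<dots> = (\<Sum>j<m. 2 ^ m * (v j \<bullet> v j))"
    by (intro sum.cong refl) (simp add: if_distrib[of "\<lambda>t. t * _"] sum.delta cong: if_cong)
  finally show ?thesis by (simp add: power2_norm_eq_inner sum_distrib_left)
qed

lemma bit_contrast_eq_bpsk: "bit_contrast m k x = (\<Sum>c\<in>codewords m. bpsk (c ! k) *\<^sub>R x c) /\<^sub>R 2 ^ m"
  by (simp add: bit_contrast_def bpsk_def)

text \<open>\<open>?p\<close> is the orthogonal projection of \<open>x\<close> onto the span of the
  bit signs. By \<open>residual\<close>, the gap between the two energies is the squared distance
  from \<open>x\<close> to \<open>?p\<close>. Conversely, orthogonality identifies the coefficients
  \<open>v k\<close> of any such combination with the contrasts.\<close>

lemma bit_contrast_energy_eq_iff: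
  fixes x :: "bool list \<Rightarrow> real ^ 'n"
  shows "(\<Sum>k<m. (norm (bit_contrast m k x))\<^sup>2) = (\<Sum>c\<in>codewords m. (norm (x c))\<^sup>2) / 2 ^ m
    \<longleftrightarrow> (\<exists>v. \<forall>c\<in>codewords m. x c = (\<Sum>k<m. bpsk (c ! k) *\<^sub>R v k))"
proof -
  let ?d = "\<lambda>k. bit_contrast m k x"
  let ?p = "\<lambda>c. \<Sum>k<m. bpsk (c ! k) *\<^sub>R ?d k"
  have cross: "(\<Sum>c\<in>codewords m. x c \<bullet> ?p c) = 2 ^ m * (\<Sum>k<m. (norm (?d k))\<^sup>2)"
  proof -
    have "(\<Sum>c\<in>codewords m. x c \<bullet> ?p c) = (\<Sum>k<m. \<Sum>c\<in>codewords m. bpsk (c ! k) * (x c \<bullet> ?d k))"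
      by (simp add: inner_sum_right) (rule sum.swap)
    also have "\<dots> = (\<Sum>k<m. (2 ^ m *\<^sub>R ?d k) \<bullet> ?d k)"
      by (rule sum.cong[OF refl]) (simp add: bit_contrast_eq_bpsk inner_sum_left sum_distrib_left mult.left_commute)
    finally show ?thesis by (simp add: power2_norm_eq_inner sum_distrib_left)
  qed
  have sq: "(norm (u - w))\<^sup>2 = (norm u)\<^sup>2 - 2 * (u \<bullet> w) + (norm w)\<^sup>2" for u w :: "real ^ 'n"
    by (simp add: power2_norm_eq_inner inner_diff_left inner_diff_right inner_commute)
  have "(\<Sum>c\<in>codewords m. (norm (x c - ?p c))\<^sup>2) =
      (\<Sum>c\<in>codewords m. (norm (x c))\<^sup>2 - 2 * (x c \<bullet> ?p c) + (norm (?p c))\<^sup>2)"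
    by (simp only: sq)
  also have "\<dots> = (\<Sum>c\<in>codewords m. (norm (x c))\<^sup>2) - 2 ^ m * (\<Sum>k<m. (norm (?d k))\<^sup>2)"
    by (simp add: sum.distrib sum_subtractf cross bpsk_combination_energy flip: sum_distrib_left)
  finally have residual: "(\<Sum>c\<in>codewords m. (norm (x c - ?p c))\<^sup>2) =
      (\<Sum>c\<in>codewords m. (norm (x c))\<^sup>2) - 2 ^ m * (\<Sum>k<m. (norm (?d k))\<^sup>2)" .
  show ?thesis
  proof
    assume "(\<Sum>k<m. (norm (?d k))\<^sup>2) = (\<Sum>c\<in>codewords m. (norm (x c))\<^sup>2) / 2 ^ m"
    then have "(\<Sum>c\<in>codewords m. (norm (x c - ?p c))\<^sup>2) = 0" using residual by simp
    then have "\<forall>c\<in>codewords m. x c = ?p c"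
      by (subst (asm) sum_nonneg_eq_0_iff) auto
    then show "\<exists>v. \<forall>c\<in>codewords m. x c = (\<Sum>k<m. bpsk (c ! k) *\<^sub>R v k)"
      by (rule exI[of _ ?d])
  next
    assume "\<exists>v. \<forall>c\<in>codewords m. x c = (\<Sum>k<m. bpsk (c ! k) *\<^sub>R v k)"
    then obtain v where v: "\<And>c. c \<in> codewords m \<Longrightarrow> x c = (\<Sum>k<m. bpsk (c ! k) *\<^sub>R v k)" by blast
    have "?d k = v k" if k: "k < m" for k
    proof -
      have "(\<Sum>c\<in>codewords m. bpsk (c ! k) *\<^sub>R x c) =
          (\<Sum>c\<in>codewords m. \<Sum>j<m. (bpsk (c ! k) * bpsk (c ! j)) *\<^sub>R v j)"
        by (intro sum.cong refl) (simp add: v scaleR_sum_right)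
      also have "\<dots> = (\<Sum>j<m. (\<Sum>c\<in>codewords m. bpsk (c ! k) * bpsk (c ! j)) *\<^sub>R v j)"
        by (subst sum.swap) (simp add: scaleR_sum_left)
      also have "\<dots> = (\<Sum>j<m. if k = j then 2 ^ m *\<^sub>R v j else 0)"
        by (intro sum.cong refl) (simp add: bpsk_orthogonal k)
      also have "\<dots> = 2 ^ m *\<^sub>R v k" using k by simp
      finally show ?thesis by (simp add: bit_contrast_eq_bpsk)
    qed
    then show "(\<Sum>k<m. (norm (?d k))\<^sup>2) = (\<Sum>c\<in>codewords m. (norm (x c))\<^sup>2) / 2 ^ m"
      using bpsk_combination_energy[where m = m and v = v] v by simp
  qed
qed

lemma bicm_foo_iff_bpsk_combination:
  fixes X :: "(real ^ 'n) list"
  assumes "fading_law \<nu> \<kappa>" and "0 < symbol_energy m X L"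
  shows "bicm_foo m X L \<nu> \<kappa> \<longleftrightarrow>
    (\<exists>v. \<forall>c\<in>codewords m. tx_symbol X L c = (\<Sum>k<m. bpsk (c ! k) *\<^sub>R v k))"
  unfolding bicm_foo_iff_energy[OF assms] bit_contrast_energy_eq_iff[symmetric]
  by (simp add: symbol_energy_def expectation_code_bits card_codewords)

section \<open>Linear labelings of rectangular constellations\<close>

text \<open>
  Greedy argument: the subset sums of the elements already identified as \<open>1, 2, \<dots>, 2\<^sup>j\<^sup>-\<^sup>1\<close> exhaust
  the numbers below \<open>2\<^sup>j\<close>, so by uniqueness \<open>2\<^sup>j\<close> can only be represented by a single new element.
\<close>

lemma unique_subset_sums_powers_of_two:
  fixes w :: "'i \<Rightarrow> nat"
  assumes fin: "finite K" and inj: "inj_on (sum w) (Pow K)" and im: "sum w ` Pow K = {..<2 ^ n}"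
  shows "j < n \<Longrightarrow> 2 ^ j \<in> w ` K"
proof (induction j rule: less_induct)
  case (less j)
  have "\<forall>i\<in>{..<j}. \<exists>q\<in>K. w q = 2 ^ i"
    using less by (fastforce simp: image_iff)
  then obtain q where q: "\<And>i. i < j \<Longrightarrow> q i \<in> K" "\<And>i. i < j \<Longrightarrow> w (q i) = 2 ^ i"
    by (metis lessThan_iff)
  have inj_q: "inj_on q A" if "A \<subseteq> {..<j}" for A
  proof (rule inj_onI)
    fix x y assume "x \<in> A" "y \<in> A" "q x = q y"
    then have "(2 :: nat) ^ x = 2 ^ y" using q(2) that by (metis lessThan_iff subsetD)
    then show "x = y" by simp
  qed
  have sum_q: "sum w (q ` A) = (\<Sum>i\<in>A. 2 ^ i)" if "A \<subseteq> {..<j}" for A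
    using that q(2) by (subst sum.reindex[OF inj_q[OF that]]) (auto intro!: sum.cong)
  \<comment> \<open>The binary digits of \<open>sum w U\<close> select identified elements with the
    same sum; injectivity of the subset sums makes this selection equal to \<open>U\<close>.\<close>
  have small: "U \<subseteq> q ` {..<j}" if U: "U \<subseteq> K" "sum w U < 2 ^ j" for U
  proof -
    let ?A = "{i. i < j \<and> bit (sum w U) i}"
    have "sum w (q ` ?A) = (\<Sum>i\<in>?A. 2 ^ i)" by (rule sum_q) auto
    also have "\<dots> = (\<Sum>i<j. of_bool (bit (sum w U) i) * 2 ^ i)"
      by (rule sum.mono_neutral_cong_left) auto
    also have "\<dots> = take_bit j (sum w U)"
      by (simp add: take_bit_sum push_bit_eq_mult lessThan_atLeast0 mult.commute)
    also have "\<dots> = sum w U" using U by (simp add: take_bit_nat_eq_self)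
    finally have "q ` ?A = U"
      using U q(1) by (intro inj_onD[OF inj]) auto
    then show ?thesis by auto
  qed
  have "(2 :: nat) ^ j < 2 ^ n" using less by simp
  then have "2 ^ j \<in> sum w ` Pow K" unfolding im by simp
  then obtain T where T: "T \<subseteq> K" "sum w T = 2 ^ j" by auto
  have finT: "finite T" using T fin finite_subset by blast
  have remove: "sum w T = w t + sum w (T - {t})" if "t \<in> T" for t
    by (rule sum.remove[OF finT that])
  \<comment> \<open>Removing an identified element would bring the sum below \<open>2 ^ j\<close>,
    so all of \<open>T\<close> would be identified; but the identified elements total only
    \<open>2 ^ j - 1\<close>.\<close>
  have "T \<inter> q ` {..<j} = {}"
  proof (rule ccontr)
    assume "T \<inter> q ` {..<j} \<noteq> {}"
    then obtain i where i: "i < j" "q i \<in> T" by auto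
    then have "0 < w (q i)" using q(2) by simp
    then have "sum w (T - {q i}) < 2 ^ j" using remove[OF i(2)] T(2) by linarith
    then have "T - {q i} \<subseteq> q ` {..<j}" using small[of "T - {q i}"] T(1) by blast
    then have "T \<subseteq> q ` {..<j}" using i by auto
    then have "sum w T \<le> sum w (q ` {..<j})" by (intro sum_mono2) auto
    also have "\<dots> < 2 ^ j"
      by (simp add: sum_q lessThan_atLeast0 sum_power2)
    finally show False using T by simp
  qed
  moreover have "T \<noteq> {}" using T by auto
  ultimately obtain t where t: "t \<in> T" "t \<notin> q ` {..<j}" by blast
  \<comment> \<open>Otherwise the singleton of \<open>t\<close> would be a small set, and
    \<open>t\<close> would be identified already.\<close>
  have "\<not> w t < 2 ^ j"
    using small[of "{t}"] t T(1) by auto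
  then have "w t = 2 ^ j" using remove[OF t(1)] T(2) by linarith
  then show ?case using t T(1) by (metis image_eqI subsetD)
qed

lemma card_codewords_prescribed:
  assumes "K \<subseteq> {..<m}"
  shows "card {c \<in> codewords m. \<forall>k\<in>K. c ! k = s k} = 2 ^ (m - card K)"
proof -
  have "bij_betw (\<lambda>c. {k \<in> {..<m} - K. c ! k}) {c \<in> codewords m. \<forall>k\<in>K. c ! k = s k} (Pow ({..<m} - K))"
    by (rule bij_betw_byWitness[of _ "\<lambda>U. map (\<lambda>k. if k \<in> K then s k else k \<in> U) [0..<m]"])
      (use assms in \<open>auto simp: in_codewords intro!: nth_equalityI\<close>)
  then have "card {c \<in> codewords m. \<forall>k\<in>K. c ! k = s k} = card (Pow ({..<m} - K))"
    by (rule bij_betw_same_card)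
  then show ?thesis
    using assms by (simp add: card_Pow card_Diff_subset finite_subset)
qed

text \<open>Two counts pin down the size of the support \<open>K\<close>. The largest value
  determines all bits in \<open>K\<close>, so it occurs at most \<open>2 ^ (m - card K)\<close>
  times, and \<open>count\<close> gives \<open>card K \<le> n\<close>. On the other hand,
  \<open>2 ^ n\<close> different values need that many subsets of \<open>K\<close>. With equality
  the subset sums of the absolute values are distinct.\<close>

lemma bpsk_pam_coefficients:
  fixes a :: "nat \<Rightarrow> real" and m n :: nat
  defines "f \<equiv> \<lambda>c. \<Sum>k<m. bpsk (c ! k) * a k"
    and "K \<equiv> {k. k < m \<and> a k \<noteq> 0}"
  assumes im: "f ` codewords m = (\<lambda>l. 2 * real l - (2 ^ n - 1)) ` {..<2 ^ n}"
    and count: "2 ^ (m - n) \<le> card {c \<in> codewords m. f c = 2 ^ n - 1}"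
    and "n \<le> m"
  shows "card K = n" and "(\<lambda>k. \<bar>a k\<bar>) ` K = (\<lambda>j. 2 ^ j) ` {..<n}"
proof -
  have K: "K \<subseteq> {..<m}" "finite K" by (auto simp: K_def)
  define T where "T = (\<lambda>c :: bool list. {k \<in> K. c ! k = (0 < a k)})"
  \<comment> \<open>With the signs of the coefficients moved into the bits, \<open>T c\<close> is
    the set of positions with a positive term. Hence \<open>f c\<close> is an affine function of a
    subset sum of \<open>b\<close>.\<close>
  define b where "b = (\<lambda>k. \<bar>a k\<bar>)"
  define D where "D = sum b K"
  have f: "f c = 2 * sum b (T c) - D" for c
  proof -
    have "f c = (\<Sum>k\<in>K. bpsk (c ! k) * a k)"
      unfolding f_def by (rule sum.mono_neutral_right) (auto simp: K_def)
    also have "\<dots> = (\<Sum>k\<in>K. (if k \<in> T c then 2 * b k else 0) - b k)"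
      by (rule sum.cong) (auto simp: K_def T_def b_def bpsk_def)
    also have "\<dots> = (\<Sum>k\<in>T c. 2 * b k) - D"
      using K(2) by (simp add: sum_subtractf D_def T_def flip: sum.inter_filter)
    finally show ?thesis by (simp add: sum_distrib_left)
  qed
  have T: "T ` codewords m = Pow K"
  proof
    show "Pow K \<subseteq> T ` codewords m"
    proof
      fix U assume "U \<in> Pow K"
      then have "T (map (\<lambda>k. (k \<in> U) = (0 < a k)) [0..<m]) = U"
        using K(1) by (auto simp: T_def)
      then show "U \<in> T ` codewords m"
        by (rule image_eqI[OF sym]) (simp add: in_codewords)
    qed
  qed (auto simp: T_def)
  have b_le: "sum b U \<le> D" if "U \<subseteq> K" for U
    unfolding D_def using that K(2) by (intro sum_mono2) (auto simp: b_def)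
  \<comment> \<open>\<open>D\<close> is the maximum of \<open>f\<close>, reached when all terms are
    positive, hence the largest PAM point.\<close>
  have D: "D = 2 ^ n - 1"
  proof (rule antisym)
    obtain c where "c \<in> codewords m" "T c = K" using T by (metis Pow_top image_iff)
    then have "D = f c" using f[of c] D_def by simp
    then have "D \<in> f ` codewords m" using \<open>c \<in> codewords m\<close> by (rule image_eqI)
    then obtain l where "l < 2 ^ n" "D = 2 * real l - (2 ^ n - 1)" unfolding im by auto
    moreover have "real l \<le> 2 ^ n - 1"
    proof -
      have "real (l + 1) \<le> real (2 ^ n)" using \<open>l < 2 ^ n\<close> by (intro of_nat_mono) simp
      then show ?thesis by simp
    qed
    ultimately show "D \<le> 2 ^ n - 1" by simp
  next
    have "2 * real (2 ^ n - 1) - (2 ^ n - 1) \<in> f ` codewords m" unfolding im by (intro imageI) simp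
    then have "(2 ^ n - 1 :: real) \<in> f ` codewords m" by (simp add: of_nat_diff)
    then obtain c where "2 ^ n - 1 = f c" by auto
    moreover have "T c \<subseteq> K" by (auto simp: T_def)
    ultimately show "2 ^ n - 1 \<le> D" using f[of c] b_le[of "T c"] by simp
  qed
  have sums: "sum b ` Pow K = real ` {..<2 ^ n}"
  proof -
    have "(\<lambda>t. (t + D) / 2) ` f ` codewords m = sum b ` T ` codewords m"
      unfolding image_image by (simp add: f)
    moreover have "(\<lambda>t. (t + D) / 2) ` f ` codewords m = real ` {..<2 ^ n}"
      unfolding im image_image by (simp add: D)
    ultimately show ?thesis by (simp add: T)
  qed
  have "{c \<in> codewords m. f c = 2 ^ n - 1} \<subseteq> {c \<in> codewords m. \<forall>k\<in>K. c ! k = (0 < a k)}"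
  proof clarify
    fix c k assume c: "f c = 2 ^ n - 1" and k: "k \<in> K"
    show "c ! k = (0 < a k)"
    proof (rule ccontr)
      assume "c ! k \<noteq> (0 < a k)"
      then have "T c \<subseteq> K - {k}" by (auto simp: T_def)
      then have "sum b (T c) \<le> sum b (K - {k})" using K(2) by (intro sum_mono2) (auto simp: b_def)
      also have "\<dots> < b k + sum b (K - {k})" using k by (simp add: b_def K_def)
      also have "\<dots> = D" unfolding D_def by (rule sum.remove[OF K(2) k, symmetric])
      finally show False using f[of c] c D by simp
    qed
  qed
  then have "card {c \<in> codewords m. f c = 2 ^ n - 1} \<le> card {c \<in> codewords m. \<forall>k\<in>K. c ! k = (0 < a k)}"
    by (rule card_mono[OF finite_bit_class])
  also have "\<dots> = 2 ^ (m - card K)"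
    by (rule card_codewords_prescribed[OF K(1)])
  finally have "card {c \<in> codewords m. f c = 2 ^ n - 1} \<le> 2 ^ (m - card K)" .
  with count have "(2 :: nat) ^ (m - n) \<le> 2 ^ (m - card K)" by (rule order_trans)
  then have "m - n \<le> m - card K" by simp
  moreover have "card K \<le> m" using card_mono[OF _ K(1)] by simp
  ultimately have le: "card K \<le> n" using \<open>n \<le> m\<close> by simp
  have "card (real ` {..<2 ^ n :: nat}) \<le> card (Pow K)"
    unfolding sums[symmetric] using K(2) by (intro card_image_le) simp
  then have "(2 :: nat) ^ n \<le> 2 ^ card K" using K(2) by (simp add: card_image card_Pow)
  with le show card: "card K = n" by simp
  \<comment> \<open>Singletons have subset sums too, so every \<open>b k\<close> is a natural number
    and rounding down changes nothing on \<open>K\<close>.\<close>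
  define w where "w = (\<lambda>k. nat \<lfloor>b k\<rfloor>)"
  have w: "real (w k) = b k" if "k \<in> K" for k
  proof -
    have "sum b {k} \<in> real ` {..<2 ^ n}" unfolding sums[symmetric] using that by (intro imageI) simp
    then show ?thesis by (auto simp: w_def)
  qed
  have "real ` sum w ` Pow K = sum b ` Pow K"
    unfolding image_image by (intro image_cong refl) (auto intro!: sum.cong w)
  then have im_w: "sum w ` Pow K = {..<2 ^ n}"
    unfolding sums by (simp add: inj_image_eq_iff)
  moreover have "inj_on (sum w) (Pow K)"
    by (rule eq_card_imp_inj_on) (use K(2) card im_w in \<open>simp_all add: card_Pow\<close>)
  ultimately have "(\<lambda>j. 2 ^ j) ` {..<n} \<subseteq> w ` K"
    using unique_subset_sums_powers_of_two[OF K(2)] by auto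
  moreover have "card (w ` K) \<le> card ((\<lambda>j. 2 ^ j :: nat) ` {..<n})"
    using card_image_le[OF K(2), of w] card by (simp add: card_image inj_on_def)
  ultimately have "w ` K = (\<lambda>j. 2 ^ j) ` {..<n}"
    using K(2) card_seteq[of "w ` K" "(\<lambda>j. 2 ^ j) ` {..<n}"] by auto
  then have "real ` w ` K = real ` (\<lambda>j. 2 ^ j) ` {..<n}" by simp
  then show "b ` K = (\<lambda>j. 2 ^ j) ` {..<n}"
    unfolding image_image using w by (simp cong: image_cong)
qed

section \<open>The natural binary code as a linear labeling\<close>

lemma nbc_nth: "i < 2 ^ m \<Longrightarrow> k < m \<Longrightarrow> nbc m ! i ! k = bit i (m - 1 - k)"
  by (simp add: nbc_def)

lemma length_nbc [simp]: "length (nbc m) = 2 ^ m"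
  by (simp add: nbc_def)

lemma length_nbc_nth: "i < 2 ^ m \<Longrightarrow> length (nbc m ! i) = m"
  by (simp add: nbc_def)

lemma nat_eq_of_bits:
  fixes i i' :: nat
  assumes "i < 2 ^ m" "i' < 2 ^ m" "\<And>k. k < m \<Longrightarrow> bit i k = bit i' k"
  shows "i = i'"
proof -
  have "take_bit m i = take_bit m i'" using assms(3) by (auto simp: bit_eq_iff bit_take_bit_iff)
  then show ?thesis using assms(1,2) by (simp add: take_bit_nat_eq_self)
qed

lemma binary_labeling_nbc: "binary_labeling m (nbc m)"
proof -
  have dist: "distinct (nbc m)"
    unfolding distinct_conv_nth
  proof (intro allI impI notI)
    fix i i' assume i: "i < length (nbc m)" "i' < length (nbc m)" "i \<noteq> i'" "nbc m ! i = nbc m ! i'"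
    have "bit i k = bit i' k" if "k < m" for k
    proof -
      have "nbc m ! i ! (m - 1 - k) = nbc m ! i' ! (m - 1 - k)" using i(4) by simp
      then show ?thesis using i(1,2) that by (simp add: nbc_nth)
    qed
    with i nat_eq_of_bits[of i m i'] show False by simp
  qed
  moreover have "set (nbc m) = codewords m"
  proof (rule card_subset_eq)
    show "set (nbc m) \<subseteq> codewords m" by (auto simp: nbc_def in_codewords)
    show "card (set (nbc m)) = card (codewords m)"
      using distinct_card[OF dist] by (simp add: card_codewords)
  qed simp
  ultimately show ?thesis by (simp add: binary_labeling_def codewords_def)
qed

lemma tx_symbol_nth:
  assumes "distinct L" "i < length L"
  shows "tx_symbol X L (L ! i) = X ! i"
proof -
  have "(THE j. j < length L \<and> L ! j = L ! i) = i"
    using assms by (auto simp: nth_eq_iff_index_eq)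
  then show ?thesis by (simp add: tx_symbol_def)
qed

lemma codewords_eq_labels:
  assumes "binary_labeling m L"
  shows "codewords m = (!) L ` {..<2 ^ m}"
  using assms binary_labeling_length[OF assms] nth_image[of "length L" L]
  by (simp add: binary_labeling_def codewords_def lessThan_atLeast0)

lemma ball_codewords_tx_symbol:
  assumes L: "binary_labeling m L"
  shows "(\<forall>c\<in>codewords m. tx_symbol X L c = g c) \<longleftrightarrow> (\<forall>i<2 ^ m. X ! i = g (L ! i))"
  using L binary_labeling_length[OF L]
  by (auto simp: codewords_eq_labels[OF L] tx_symbol_nth binary_labeling_def)

lemma pam_nth: "l < 2 ^ n \<Longrightarrow> pam (2 ^ n) ! l = 2 * real l - (2 ^ n - 1)"
  by (simp add: pam_def)

lemma distinct_qam: "distinct (qam M1 M2)"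
proof -
  have "distinct (pam M)" for M by (simp add: pam_def distinct_map inj_on_def)
  then have "distinct (List.product (pam M1) (pam M2))" by (simp add: distinct_product)
  moreover have "inj (\<lambda>(a, b). vector [a, b] :: real ^ 2)"
    by (auto simp: inj_def vec_eq_iff forall_2)
  ultimately show ?thesis
    unfolding qam_def distinct_map by (auto intro: inj_on_subset)
qed

lemma qam_component:
  assumes "i < 2 ^ (m1 + m2)"
  shows "(qam (2 ^ m1) (2 ^ m2) ! i) $ 1 = 2 * real (i div 2 ^ m2) - (2 ^ m1 - 1)"
    and "(qam (2 ^ m1) (2 ^ m2) ! i) $ 2 = 2 * real (i mod 2 ^ m2) - (2 ^ m2 - 1)"
proof -
  have l: "i div 2 ^ m2 < 2 ^ m1" using assms by (simp add: power_add less_mult_imp_div_less)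
  have j: "i mod 2 ^ m2 < 2 ^ m2" by simp
  have "qam (2 ^ m1) (2 ^ m2) ! i = vector [pam (2 ^ m1) ! (i div 2 ^ m2), pam (2 ^ m2) ! (i mod 2 ^ m2)]"
    using qam_nth[OF l j] by simp
  then show "(qam (2 ^ m1) (2 ^ m2) ! i) $ 1 = 2 * real (i div 2 ^ m2) - (2 ^ m1 - 1)"
    "(qam (2 ^ m1) (2 ^ m2) ! i) $ 2 = 2 * real (i mod 2 ^ m2) - (2 ^ m2 - 1)"
    using pam_nth[OF l] pam_nth[OF j] by simp_all
qed

text \<open>A sign is \<open>2 * d - 1\<close> for the digit \<open>d\<close>, so the signed
  expansion is twice the number minus the sum of all weights: a PAM point.\<close>

lemma bpsk_binary_expansion:
  assumes "l < 2 ^ n"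
  shows "(\<Sum>k<n. bpsk (bit l k) * 2 ^ k) = 2 * real l - (2 ^ n - 1)"
proof -
  have "(\<Sum>k<n. bpsk (bit l k) * 2 ^ k) = (\<Sum>k<n. 2 * real (of_bool (bit l k) * 2 ^ k) - 2 ^ k)"
    by (rule sum.cong) (auto simp: bpsk_def)
  also have "\<dots> = 2 * real (\<Sum>k<n. of_bool (bit l k) * 2 ^ k) - (\<Sum>k<n. 2 ^ k)"
    by (simp only: sum_subtractf of_nat_sum sum_distrib_left)
  also have "(\<Sum>k<n. of_bool (bit l k) * 2 ^ k) = l"
    using assms take_bit_sum[of n l]
    by (simp add: take_bit_nat_eq_self push_bit_eq_mult lessThan_atLeast0 mult.commute)
  also have "(\<Sum>k<n. 2 ^ k :: real) = 2 ^ n - 1"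
    by (induction n) simp_all
  finally show ?thesis .
qed

text \<open>The leading \<open>m1\<close> bits of \<open>i\<close> are the digits of
  \<open>i div 2 ^ m2\<close> and act on the first coordinate; the others are the digits of
  \<open>i mod 2 ^ m2\<close> and act on the second. Exponents decrease because the most significant
  bit comes first.\<close>

definition nbc_vector :: "nat \<Rightarrow> nat \<Rightarrow> nat \<Rightarrow> real ^ 2" where
  "nbc_vector m1 m2 k =
     (if k < m1 then vector [2 ^ (m1 - 1 - k), 0] else vector [0, 2 ^ (m1 + m2 - 1 - k)])"

lemma qam_nth_nbc:
  assumes i: "i < 2 ^ (m1 + m2)"
  shows "qam (2 ^ m1) (2 ^ m2) ! i =
    (\<Sum>k<m1 + m2. bpsk (nbc (m1 + m2) ! i ! k) *\<^sub>R nbc_vector m1 m2 k)"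
proof -
  have split: "(\<Sum>k<m1 + m2. g k) = (\<Sum>k<m1. g k) + (\<Sum>k<m2. g (m1 + k))" for g :: "nat \<Rightarrow> real"
    by (induction m2) (simp_all add: add.assoc)
  have l: "i div 2 ^ m2 < 2 ^ m1" using i by (simp add: power_add less_mult_imp_div_less)
  have "(\<Sum>k<m1 + m2. bpsk (nbc (m1 + m2) ! i ! k) * (nbc_vector m1 m2 k $ 1)) =
      (\<Sum>k<m1. bpsk (bit (i div 2 ^ m2) (m1 - Suc k)) * 2 ^ (m1 - Suc k))"
    unfolding split using i
    by (auto simp: nbc_vector_def nbc_nth drop_bit_eq_div[symmetric] bit_drop_bit_eq add.commute[of m2 m1] intro!: sum.cong)
  also have "\<dots> = (\<Sum>k<m1. bpsk (bit (i div 2 ^ m2) k) * 2 ^ k)"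
    by (rule sum.nat_diff_reindex)
  finally have 1: "(\<Sum>k<m1 + m2. bpsk (nbc (m1 + m2) ! i ! k) * (nbc_vector m1 m2 k $ 1)) =
      2 * real (i div 2 ^ m2) - (2 ^ m1 - 1)"
    using bpsk_binary_expansion[OF l] by simp
  have "(\<Sum>k<m1 + m2. bpsk (nbc (m1 + m2) ! i ! k) * (nbc_vector m1 m2 k $ 2)) =
      (\<Sum>k<m2. bpsk (bit (i mod 2 ^ m2) (m2 - Suc k)) * 2 ^ (m2 - Suc k))"
    unfolding split using i
    by (auto simp: nbc_vector_def nbc_nth take_bit_eq_mod[symmetric] bit_take_bit_iff intro!: sum.cong)
  also have "\<dots> = (\<Sum>k<m2. bpsk (bit (i mod 2 ^ m2) k) * 2 ^ k)"
    by (rule sum.nat_diff_reindex)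
  finally have 2: "(\<Sum>k<m1 + m2. bpsk (nbc (m1 + m2) ! i ! k) * (nbc_vector m1 m2 k $ 2)) =
      2 * real (i mod 2 ^ m2) - (2 ^ m2 - 1)"
    using bpsk_binary_expansion[of "i mod 2 ^ m2" m2] by simp
  show ?thesis
    using 1 2 by (simp add: vec_eq_iff forall_2 qam_component[OF i])
qed

section \<open>Derivable labelings and linear representations\<close>

lemma derived_labeling_nth:
  assumes "\<sigma> permutes {..<m}" "i < 2 ^ m" "k < m"
  shows "permute_columns \<sigma> (invert_columns S (nbc m)) ! i ! k = (nbc m ! i ! \<sigma> k \<noteq> (\<sigma> k \<in> S))"
proof -
  have "\<sigma> k < m" using assms(1,3) permutes_in_image[of \<sigma> "{..<m}" k] by simp
  then show ?thesis
    using assms by (simp add: permute_columns_def invert_columns_def permute_list_def length_nbc_nth)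
qed

lemma derivable_imp_bpsk_combination:
  fixes m1 m2 :: nat
  defines "m \<equiv> m1 + m2"
  assumes "L = nbc m \<or> derivable_labeling m (nbc m) L"
  shows "\<exists>v. \<forall>i<2 ^ m. qam (2 ^ m1) (2 ^ m2) ! i = (\<Sum>k<m. bpsk (L ! i ! k) *\<^sub>R v k)"
  using assms(2)
proof
  assume "L = nbc m"
  then show ?thesis using qam_nth_nbc[of _ m1 m2] m_def by (intro exI[of _ "nbc_vector m1 m2"]) simp
next
  assume "derivable_labeling m (nbc m) L"
  then obtain S \<sigma> where \<sigma>: "\<sigma> permutes {..<m}" and L: "L = permute_columns \<sigma> (invert_columns S (nbc m))"
    by (auto simp: derivable_labeling_def)
  let ?u = "nbc_vector m1 m2"
  \<comment> \<open>Permuting the columns permutes the coefficient vectors, and inverting a column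
    negates its vector.\<close>
  have "qam (2 ^ m1) (2 ^ m2) ! i = (\<Sum>k<m. bpsk (L ! i ! k) *\<^sub>R (bpsk (\<sigma> k \<notin> S) *\<^sub>R ?u (\<sigma> k)))"
    if i: "i < 2 ^ m" for i
  proof -
    have "qam (2 ^ m1) (2 ^ m2) ! i = (\<Sum>k<m. bpsk (nbc m ! i ! k) *\<^sub>R ?u k)"
      using qam_nth_nbc i by (simp add: m_def)
    also have "\<dots> = (\<Sum>k<m. bpsk (nbc m ! i ! \<sigma> k) *\<^sub>R ?u (\<sigma> k))"
      using sum.permute[OF \<sigma>, of "\<lambda>k. bpsk (nbc m ! i ! k) *\<^sub>R ?u k"] by (simp add: o_def)
    also have "\<dots> = (\<Sum>k<m. bpsk (L ! i ! k) *\<^sub>R (bpsk (\<sigma> k \<notin> S) *\<^sub>R ?u (\<sigma> k)))"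
      by (rule sum.cong) (auto simp: L derived_labeling_nth[OF \<sigma> i] bpsk_def)
    finally show ?thesis .
  qed
  then show ?thesis by (intro exI[of _ "\<lambda>k. bpsk (\<sigma> k \<notin> S) *\<^sub>R ?u (\<sigma> k)"]) simp
qed

text \<open>
  One coordinate of a rectangular constellation, \<open>g i\<close> being the row or the column of the point \<open>i\<close>
  and \<open>e\<close> an enumeration of the points with the largest coordinate.
\<close>

lemma coordinate_coefficients:
  fixes a :: "nat \<Rightarrow> real" and g e :: "nat \<Rightarrow> nat" and m n :: nat
  defines "K \<equiv> {k. k < m \<and> a k \<noteq> 0}"
  assumes L: "binary_labeling m L" and "n \<le> m"
    and a: "\<And>i. i < 2 ^ m \<Longrightarrow> (\<Sum>k<m. bpsk (L ! i ! k) * a k) = 2 * real (g i) - (2 ^ n - 1)"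
    and g: "g ` {..<2 ^ m} = {..<2 ^ n}"
    and e: "inj_on e {..<2 ^ (m - n)}" "\<And>j. j < 2 ^ (m - n) \<Longrightarrow> e j < 2 ^ m \<and> g (e j) = 2 ^ n - 1"
  shows "card K = n" and "(\<lambda>k. \<bar>a k\<bar>) ` K = (\<lambda>j. 2 ^ j) ` {..<n}"
proof -
  let ?f = "\<lambda>c. \<Sum>k<m. bpsk (c ! k) * a k"
  have "?f ` codewords m = (\<lambda>i. 2 * real (g i) - (2 ^ n - 1)) ` {..<2 ^ m}"
    unfolding codewords_eq_labels[OF L] image_image by (rule image_cong) (simp_all add: a)
  also have "\<dots> = (\<lambda>l. 2 * real l - (2 ^ n - 1)) ` {..<2 ^ n}"
    unfolding g[symmetric] image_image ..
  finally have im: "?f ` codewords m = (\<lambda>l. 2 * real l - (2 ^ n - 1)) ` {..<2 ^ n}" .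
  have "inj_on (\<lambda>j. L ! e j) {..<2 ^ (m - n)}"
    using L binary_labeling_length[OF L] e
    by (auto simp: inj_on_def binary_labeling_def nth_eq_iff_index_eq)
  then have "2 ^ (m - n) = card ((\<lambda>j. L ! e j) ` {..<2 ^ (m - n)})"
    by (simp add: card_image)
  also have "\<dots> \<le> card {c \<in> codewords m. ?f c = 2 ^ n - 1}"
    by (rule card_mono[OF finite_bit_class])
      (use e a in \<open>auto simp: codewords_eq_labels[OF L] of_nat_diff\<close>)
  finally have count: "2 ^ (m - n) \<le> card {c \<in> codewords m. ?f c = 2 ^ n - 1}" .
  show "card K = n" "(\<lambda>k. \<bar>a k\<bar>) ` K = (\<lambda>j. 2 ^ j) ` {..<n}"
    unfolding K_def by (rule bpsk_pam_coefficients[OF im count \<open>n \<le> m\<close>])+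
qed

text \<open>The coordinate supports have sizes \<open>m1\<close> and \<open>m2\<close> and cover all
  \<open>m1 + m2\<close> positions, hence are disjoint. So each \<open>v k\<close> is, up to sign,
  one of the vectors of the natural binary code. Its position there yields the permutation and its
  sign the inversions.\<close>

lemma bpsk_combination_imp_derivable:
  fixes m1 m2 :: nat and v :: "nat \<Rightarrow> real ^ 2"
  defines "m \<equiv> m1 + m2"
  assumes L: "binary_labeling m L"
    and v: "\<And>i. i < 2 ^ m \<Longrightarrow> qam (2 ^ m1) (2 ^ m2) ! i = (\<Sum>k<m. bpsk (L ! i ! k) *\<^sub>R v k)"
  shows "derivable_labeling m (nbc m) L"
proof -
  let ?X = "qam (2 ^ m1) (2 ^ m2)" and ?u = "nbc_vector m1 m2" and ?N = "nbc m"
  have len: "length L = 2 ^ m" "length ?X = 2 ^ m" and dist: "distinct L"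
    using binary_labeling_length[OF L] L by (auto simp: length_qam m_def power_add binary_labeling_def)
  have len_row: "length (L ! i) = m" if "i < 2 ^ m" for i
    using codewords_eq_labels[OF L] that in_codewords by auto
  have X_inj: "i = i'" if "?X ! i = ?X ! i'" "i < 2 ^ m" "i' < 2 ^ m" for i i'
    using that nth_eq_iff_index_eq[OF distinct_qam, of i "2 ^ m1" "2 ^ m2" i'] len by simp
  define K where "K = (\<lambda>r. {k. k < m \<and> v k $ r \<noteq> 0})"
  have K1: "card (K 1) = m1" "(\<lambda>k. \<bar>v k $ 1\<bar>) ` K 1 = (\<lambda>j. 2 ^ j) ` {..<m1}"
  proof -
    \<comment> \<open>\<open>?e\<close> runs through the points with the largest first coordinate, a
      block of consecutive indices.\<close>
    let ?g = "\<lambda>i. i div 2 ^ m2 :: nat" and ?e = "\<lambda>j. 2 ^ m2 * (2 ^ m1 - 1) + j :: nat"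
    have a: "(\<Sum>k<m. bpsk (L ! i ! k) * (v k $ 1)) = 2 * real (?g i) - (2 ^ m1 - 1)" if "i < 2 ^ m" for i
      using qam_component(1)[of i m1 m2] v[OF that] that by (simp add: m_def)
    have g: "?g ` {..<2 ^ m} = {..<2 ^ m1}"
    proof
      show "?g ` {..<2 ^ m} \<subseteq> {..<2 ^ m1}"
        by (auto simp: m_def power_add less_mult_imp_div_less)
      show "{..<2 ^ m1} \<subseteq> ?g ` {..<2 ^ m}"
      proof
        fix l :: nat assume "l \<in> {..<2 ^ m1}"
        then show "l \<in> ?g ` {..<2 ^ m}" by (intro image_eqI[of _ _ "l * 2 ^ m2"]) (simp_all add: m_def power_add)
      qed
    qed
    have e: "?e j < 2 ^ m \<and> ?g (?e j) = 2 ^ m1 - 1" if "j < 2 ^ (m - m1)" for j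
    proof -
      have "?e j < 2 ^ m2 * (2 ^ m1 - 1) + 2 ^ m2" using that by (simp add: m_def)
      also have "\<dots> = 2 ^ m" by (simp add: m_def power_add algebra_simps)
      finally show ?thesis using that by (simp add: m_def)
    qed
    show "card (K 1) = m1" "(\<lambda>k. \<bar>v k $ 1\<bar>) ` K 1 = (\<lambda>j. 2 ^ j) ` {..<m1}"
      unfolding K_def by (rule coordinate_coefficients[OF L _ a g _ e]; simp add: m_def)+
  qed
  have K2: "card (K 2) = m2" "(\<lambda>k. \<bar>v k $ 2\<bar>) ` K 2 = (\<lambda>j. 2 ^ j) ` {..<m2}"
  proof -
    \<comment> \<open>The points with the largest second coordinate are the last ones of the blocks
      of length \<open>2 ^ m2\<close>.\<close>
    let ?g = "\<lambda>i. i mod 2 ^ m2 :: nat" and ?e = "\<lambda>l. 2 ^ m2 * l + (2 ^ m2 - 1) :: nat"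
    have a: "(\<Sum>k<m. bpsk (L ! i ! k) * (v k $ 2)) = 2 * real (?g i) - (2 ^ m2 - 1)" if "i < 2 ^ m" for i
      using qam_component(2)[of i m1 m2] v[OF that] that by (simp add: m_def)
    have g: "?g ` {..<2 ^ m} = {..<2 ^ m2}"
    proof
      show "{..<2 ^ m2} \<subseteq> ?g ` {..<2 ^ m}"
      proof
        fix j :: nat assume "j \<in> {..<2 ^ m2}"
        moreover have "(2 :: nat) ^ m2 \<le> 2 ^ m" by (simp add: m_def)
        ultimately show "j \<in> ?g ` {..<2 ^ m}" by (intro image_eqI[of _ _ j]) (simp_all del: power_increasing_iff)
      qed
    qed auto
    have e: "?e l < 2 ^ m \<and> ?g (?e l) = 2 ^ m2 - 1" if "l < 2 ^ (m - m2)" for l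
    proof -
      have "(0 :: nat) < 2 ^ m2" by simp
      then have "2 ^ m2 * l + (2 ^ m2 - 1) < 2 ^ m2 * Suc l" unfolding mult_Suc_right by linarith
      also have "\<dots> \<le> 2 ^ m2 * 2 ^ m1" using that by (intro mult_le_mono2) (simp add: m_def)
      also have "\<dots> = 2 ^ m" by (simp add: m_def power_add)
      finally have "?e l < 2 ^ m" .
      moreover have "?g (?e l) = (2 ^ m2 - 1) mod 2 ^ m2" by (rule mod_mult_self4)
      ultimately show ?thesis by simp
    qed
    have inj: "inj_on ?e A" for A
    proof (rule inj_onI)
      fix x y assume "?e x = ?e y"
      then have "2 ^ m2 * x = 2 ^ m2 * y" by (rule add_right_imp_eq)
      then show "x = y" by simp
    qed
    show "card (K 2) = m2" "(\<lambda>k. \<bar>v k $ 2\<bar>) ` K 2 = (\<lambda>j. 2 ^ j) ` {..<m2}"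
      unfolding K_def by (rule coordinate_coefficients[OF L _ a g inj e]; simp add: m_def)+
  qed
  have finK: "finite (K r)" "K r \<subseteq> {..<m}" for r by (auto simp: K_def)
  text \<open>Flipping a bit with zero coefficient would not move the point.\<close>
  have cover: "K 1 \<union> K 2 = {..<m}"
  proof (rule ccontr)
    assume "K 1 \<union> K 2 \<noteq> {..<m}"
    then obtain k where k: "k < m" "k \<notin> K 1" "k \<notin> K 2" using finK(2) by blast
    then have "v k = 0" by (simp add: K_def vec_eq_iff forall_2)
    let ?c = "replicate m True" and ?c' = "(replicate m True)[k := False]"
    obtain i i' where i: "i < 2 ^ m" "L ! i = ?c" "i' < 2 ^ m" "L ! i' = ?c'"
      using codewords_eq_labels[OF L] in_codewords[of ?c m] in_codewords[of ?c' m]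
      by (auto simp: image_iff)
    have "?X ! i = ?X ! i'"
      unfolding v[OF i(1)] v[OF i(3)] i(2,4)
    proof (rule sum.cong[OF refl])
      fix p
      show "bpsk (?c ! p) *\<^sub>R v p = bpsk (?c' ! p) *\<^sub>R v p"
        by (cases "p = k") (simp_all add: \<open>v k = 0\<close>)
    qed
    then have "?c ! k = ?c' ! k" using X_inj i by metis
    then show False using k(1) by simp
  qed
  have disjoint: "K 1 \<inter> K 2 = {}"
  proof -
    have "card (K 1) + card (K 2) = card (K 1 \<union> K 2) + card (K 1 \<inter> K 2)"
      by (rule card_Un_Int) (rule finK)+
    then show ?thesis using K1(1) K2(1) finK(1) by (simp add: cover m_def)
  qed
  have inj1: "inj_on (\<lambda>k. \<bar>v k $ 1\<bar>) (K 1)"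
    by (rule eq_card_imp_inj_on) (simp_all add: finK K1 card_image inj_on_def)
  have inj2: "inj_on (\<lambda>k. \<bar>v k $ 2\<bar>) (K 2)"
    by (rule eq_card_imp_inj_on) (simp_all add: finK K2 card_image inj_on_def)
  have "\<exists>p<m. \<exists>b. v k = bpsk b *\<^sub>R ?u p" if k: "k < m" for k
  proof (cases "k \<in> K 1")
    case True
    then have "v k $ 2 = 0" using disjoint k by (auto simp: K_def)
    obtain j where j: "j < m1" "\<bar>v k $ 1\<bar> = 2 ^ j" using K1(2) True by blast
    let ?p = "m1 - 1 - j"
    have "?p < m1" "m1 - 1 - ?p = j" using j by auto
    then have "v k = bpsk (0 < v k $ 1) *\<^sub>R ?u ?p"
      using j(2) \<open>v k $ 2 = 0\<close> by (auto simp: vec_eq_iff forall_2 nbc_vector_def bpsk_def abs_if split: if_splits)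
    with \<open>?p < m1\<close> show ?thesis by (intro exI[of _ ?p] conjI exI) (auto simp: m_def)
  next
    case False
    then have "v k $ 1 = 0" "k \<in> K 2" using cover k by (auto simp: K_def)
    obtain j where j: "j < m2" "\<bar>v k $ 2\<bar> = 2 ^ j" using K2(2) \<open>k \<in> K 2\<close> by blast
    let ?p = "m - 1 - j"
    have p: "?p < m" "\<not> ?p < m1" "m1 + m2 - 1 - ?p = j" using j by (auto simp: m_def)
    then have "v k = bpsk (0 < v k $ 2) *\<^sub>R ?u ?p"
      using j(2) \<open>v k $ 1 = 0\<close> by (auto simp: vec_eq_iff forall_2 nbc_vector_def bpsk_def abs_if split: if_splits)
    with p(1) show ?thesis by blast
  qed
  then obtain \<tau> \<beta> where \<tau>: "\<And>k. k < m \<Longrightarrow> \<tau> k < m" and v_eq: "\<And>k. k < m \<Longrightarrow> v k = bpsk (\<beta> k) *\<^sub>R ?u (\<tau> k)"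
    by metis
  have "inj_on \<tau> {..<m}"
  proof (rule inj_onI)
    fix k k' assume kk: "k \<in> {..<m}" "k' \<in> {..<m}" "\<tau> k = \<tau> k'"
    have abs: "\<bar>v k $ r\<bar> = \<bar>v k' $ r\<bar>" for r
      using kk v_eq[of k] v_eq[of k'] by (auto simp: bpsk_def)
    then have same: "k \<in> K r \<longleftrightarrow> k' \<in> K r" for r
      using kk by (auto simp: K_def) (metis abs_zero abs_eq_0)+
    show "k = k'"
    proof (cases "k \<in> K 1")
      case True
      then show ?thesis using inj_onD[OF inj1 abs] same by blast
    next
      case False
      then have "k \<in> K 2" using cover kk by blast
      then show ?thesis using inj_onD[OF inj2 abs] same by blast
    qed
  qed
  moreover have "\<tau> ` {..<m} \<subseteq> {..<m}" using \<tau> by auto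
  ultimately have bij: "bij_betw \<tau> {..<m} {..<m}"
    by (simp add: bij_betw_def endo_inj_surj)
  define \<sigma> where "\<sigma> = (\<lambda>k. if k < m then \<tau> k else k)"
  have \<sigma>: "\<sigma> permutes {..<m}"
  proof (rule bij_imp_permutes)
    have "bij_betw \<sigma> {..<m} {..<m} \<longleftrightarrow> bij_betw \<tau> {..<m} {..<m}"
      by (rule bij_betw_cong) (simp add: \<sigma>_def)
    with bij show "bij_betw \<sigma> {..<m} {..<m}" by simp
  qed (simp add: \<sigma>_def)
  \<comment> \<open>Columns are inverted before they are permuted, so \<open>S\<close> consists of
    column numbers of the natural binary code, that is, of images under
    \<open>\<tau>\<close>.\<close>
  define S where "S = \<tau> ` {k. k < m \<and> \<not> \<beta> k}"
  have \<sigma>_S: "\<sigma> k \<in> S \<longleftrightarrow> \<not> \<beta> k" if "k < m" for k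
    using that \<open>inj_on \<tau> {..<m}\<close> by (auto simp: S_def \<sigma>_def dest: inj_onD)
  have labels: "L ! i ! k = (?N ! i ! \<sigma> k \<noteq> (\<sigma> k \<in> S))" if i: "i < 2 ^ m" and k: "k < m" for i k
  proof -
    \<comment> \<open>The codeword of row \<open>i\<close> with the permutation and the inversions
      undone. The point with this natural binary label is the point \<open>i\<close> itself, and
      points are distinct, so it is row \<open>i\<close> of the code.\<close>
    let ?c = "map (\<lambda>p. L ! i ! inv \<sigma> p = \<beta> (inv \<sigma> p)) [0..<m]"
    obtain i' where i': "i' < 2 ^ m" "?N ! i' = ?c"
      using codewords_eq_labels[OF binary_labeling_nbc[of m]] in_codewords[of ?c m]
      by (auto simp: image_iff)
    have "?X ! i = (\<Sum>k<m. bpsk (?c ! \<sigma> k) *\<^sub>R ?u (\<sigma> k))"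
      unfolding v[OF i]
    proof (rule sum.cong[OF refl])
      fix k assume "k \<in> {..<m}"
      then have k: "k < m" "\<sigma> k < m" "\<sigma> k = \<tau> k" using \<tau> by (auto simp: \<sigma>_def)
      then show "bpsk (L ! i ! k) *\<^sub>R v k = bpsk (?c ! \<sigma> k) *\<^sub>R ?u (\<sigma> k)"
        using permutes_inverses(2)[OF \<sigma>, of k] by (auto simp: v_eq bpsk_def)
    qed
    also have "\<dots> = (\<Sum>p<m. bpsk (?c ! p) *\<^sub>R ?u p)"
      using sum.permute[OF \<sigma>, of "\<lambda>p. bpsk (?c ! p) *\<^sub>R ?u p"] by (simp only: o_def)
    also have "\<dots> = ?X ! i'"
      using qam_nth_nbc[of i' m1 m2] i' by (simp add: m_def)
    finally have "i = i'" using X_inj i i' by blast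
    then have "?N ! i ! \<sigma> k = (L ! i ! k = \<beta> k)"
      using i' k \<tau>[OF k] permutes_inverses(2)[OF \<sigma>, of k] by (simp add: \<sigma>_def)
    then show ?thesis using \<sigma>_S[OF k] by auto
  qed
  have "L = permute_columns \<sigma> (invert_columns S ?N)"
  proof (rule nth_equalityI)
    show len': "length L = length (permute_columns \<sigma> (invert_columns S ?N))"
      by (simp add: permute_columns_def invert_columns_def len)
    fix i assume "i < length L"
    then have i: "i < 2 ^ m" using len by simp
    show "L ! i = permute_columns \<sigma> (invert_columns S ?N) ! i"
    proof (rule nth_equalityI)
      show "length (L ! i) = length (permute_columns \<sigma> (invert_columns S ?N) ! i)"
        using i by (simp add: permute_columns_def invert_columns_def len_row length_nbc_nth)
      fix k assume "k < length (L ! i)"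
      then show "L ! i ! k = permute_columns \<sigma> (invert_columns S ?N) ! i ! k"
        using labels[OF i] derived_labeling_nth[OF \<sigma> i] len_row[OF i] by simp
    qed
  qed
  moreover have "S \<subseteq> {..<m}" using \<tau> by (auto simp: S_def)
  ultimately show ?thesis using \<sigma> by (auto simp: derivable_labeling_def)
qed

lemma qam_symbol_energy_pos:
  assumes L: "binary_labeling (m1 + m2) L" and "1 \<le> m1"
  shows "0 < symbol_energy (m1 + m2) (qam (2 ^ m1) (2 ^ m2)) L"
proof -
  let ?x = "tx_symbol (qam (2 ^ m1) (2 ^ m2)) L"
  have L0: "L ! 0 \<in> codewords (m1 + m2)" unfolding codewords_eq_labels[OF L] by simp
  have "?x (L ! 0) $ 1 = - (2 ^ m1 - 1)"
    using L binary_labeling_length[OF L] qam_component(1)[of 0 m1 m2]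
    by (simp add: tx_symbol_nth binary_labeling_def)
  \<comment> \<open>Here \<open>1 \<le> m1\<close> makes the first coordinate of the corner point
    nonzero.\<close>
  moreover have "(1 :: real) < 2 ^ m1" using assms(2) by simp
  ultimately have "?x (L ! 0) \<noteq> 0" by auto
  then have "0 < (\<Sum>c\<in>codewords (m1 + m2). (norm (?x c))\<^sup>2)"
    by (intro sum_pos2[OF _ L0]) auto
  then show ?thesis
    by (simp add: symbol_energy_def expectation_code_bits card_codewords)
qed

theorem corollary16:
  fixes m1 m2 m :: nat
    and L :: "bool list list"
    and \<nu> :: "(real ^ 2) measure" and \<kappa> :: "real measure"
  assumes "1 \<le> m1" and "1 \<le> m2" and "(2::nat) ^ m1 * 2 ^ m2 = 2 ^ m"
    and "binary_labeling m L"
    and "fading_law \<nu> \<kappa>"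
  shows "bicm_foo m (qam (2 ^ m1) (2 ^ m2)) L \<nu> \<kappa> \<longleftrightarrow>
           L = nbc m \<or> derivable_labeling m (nbc m) L"
proof -
  have "(2::nat) ^ (m1 + m2) = 2 ^ m" using assms(3) by (simp add: power_add)
  then have m: "m = m1 + m2" by simp
  note L = assms(4)[unfolded m]
  let ?X = "qam (2 ^ m1) (2 ^ m2)"
  have "bicm_foo m ?X L \<nu> \<kappa> \<longleftrightarrow>
      (\<exists>v. \<forall>i<2 ^ (m1 + m2). ?X ! i = (\<Sum>k<m1 + m2. bpsk (L ! i ! k) *\<^sub>R v k))"
    unfolding m bicm_foo_iff_bpsk_combination[OF assms(5) qam_symbol_energy_pos[OF L assms(1)]]
      ball_codewords_tx_symbol[OF L] ..
  also have "\<dots> \<longleftrightarrow> L = nbc m \<or> derivable_labeling m (nbc m) L"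
    using derivable_imp_bpsk_combination[of L m1 m2] bpsk_combination_imp_derivable[OF L]
    unfolding m by blast
  finally show ?thesis .
qed

end
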